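(* Suppose all agents have identical uncertainty classes $(\mathcal{P}_0,\mathcal{P}_1)$ with least favorable distributions $(Q_0,Q_1)$, and that every agent $k>1$ uses the same decision rule $\phi$, agent 1 using a rule $\phi_1$. Let $\phi_*$ be the randomized likelihood ratio test between $Q_0$ and $Q_1$ such that $$\phi_*=\arg\min_\phi\lim_{k\to\infty}P_{e,k}((\phi_1,\phi),Q_0^k,Q_1^k).$$ Then $$\inf_\phi P_\infty^{\mathrm{DD}}(\phi)=\lim_{k\to\infty}P_{e,k}((\phi_1,\phi_* ),Q_0^k,Q_1^k).$$
   Context: Infinite tandem network: agents $1,2,\dots$; the true hypothesis $H$ is $H_i$ with prior probability $\pi_i\in(0,1)$, $i=0,1$, $\pi_0+\pi_1=1$. Conditioned on $H=H_i$, agent $k$ observes $Y_k$ in a measurable space $(\mathcal{Y},\mathcal{A})$ with (unknown) distribution in the uncertainty class $\mathcal{P}_i=\{(1-\epsilon_i)P_i^*+\epsilon_iR : R\in\mathcal{R}\}$ (the same for all agents), where $\mathcal{R}$ is the set of all probability measures on $(\mathcal{Y},\mathcal{A})$, $P_i^*\in\mathcal{R}$ is the nominal distribution, and the contamination $\epsilon_i\in[0,1)$ is small enough that $\mathcal{P}_0,\mathcal{P}_1$ are disjoint. All distributions in $\mathcal{P}_0$ and $\mathcal{P}_1$ are assumed absolutely continuous with respect to one another. Given $H$, the observations are independent across agents (different agents may have different laws within the class). $\mathcal{P}_i^k$ is the set of product laws $P_i^{(k)}=P_{i,1}\times\cdots\times P_{i,k}$ with all $P_{i,j}\in\mathcal{P}_i$.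 Agent 1 decides $U_1=\phi_1(Y_1)\in\{0,1\}$; agent $k\ge2$ decides $U_k=\phi(Y_k,U_{k-1})\in\{0,1\}$, where rules may be randomized (with randomization independent of everything else). $(\phi_1,\phi)$ denotes this sequence of rules. $P_{e,k}((\phi_1,\phi),P_0^{(k)},P_1^{(k)})=\pi_0P_0^{(k)}(U_k=1)+\pi_1P_1^{(k)}(U_k=0)$; $P_k^{\mathrm{DD}}(\phi_1,\phi)=\sup_{(P_0^{(k)},P_1^{(k)})\in\mathcal{P}_0^k\times\mathcal{P}_1^k}P_{e,k}((\phi_1,\phi),P_0^{(k)},P_1^{(k)})$; and $P_\infty^{\mathrm{DD}}(\phi)=\lim_{k\to\infty}P_k^{\mathrm{DD}}(\phi_1,\phi)$. It is a convention here that these limits are taken to exist and that $P_\infty^{\mathrm{DD}}(\phi)$ does not depend on $\phi_1$. Least favorable distributions $(Q_0,Q_1)$ of $(\mathcal{P}_0,\mathcal{P}_1)$: with $p_i^*$ the density of $P_i^*$ with respect to a common measure, they have densities $q_0=(1-\epsilon_0)p_0^*$ where $p_1^*/p_0^*<c''$, $q_0=(1-\epsilon_0)p_1^*/c''$ where $p_1^*/p_0^*\ge c''$; $q_1=(1-\epsilon_1)p_1^*$ where $p_1^*/p_0^*>c'$, $q_1=c'(1-\epsilon_1)p_0^*$ where $p_1^*/p_0^*\le c'$, with $0\le c'<c''\le\infty$ determined so that $q_0,q_1$ are probability densities. $Q_i^k$ is the $k$-fold product of $Q_i$, and $l^*(y)=q_1(y)/q_0(y)$. A randomized likelihood ratio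 test between $Q_0$ and $Q_1$ is a rule of the form (cases read in order): $u_k=0$ if $l^*(Y_k)<t_1$; $u_k=A$ if $l^*(Y_k)=t_1$; $u_k=u_{k-1}$ if $t_1<l^*(Y_k)<t_0$; $u_k=B$ if $l^*(Y_k)=t_0$; $u_k=1$ if $l^*(Y_k)>t_0$. Here $A$ equals $0$ with probability $p$ and $u_{k-1}$ with probability $1-p$; $B$ equals $u_{k-1}$ with probability $q$ and $1$ with probability $1-q$; $t_0,t_1$ and $p,q\in[0,1]$ are constants. *)

theory Defs
  imports "HOL-Probability.Probability"
begin

text \<open>
  A measurable space is represented by a measure \<open>M\<close> of which only \<open>space M\<close> and \<open>sets M\<close>
  matter, except that \<open>M\<close> itself serves as the common dominating measure wherever densities occur.
  Hypotheses and decisions 0 and 1 are the booleans \<open>False\<close> and \<open>True\<close>.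
\<close>

definition contamination_class :: "'a measure \<Rightarrow> real \<Rightarrow> 'a measure \<Rightarrow> 'a measure set" where
  "contamination_class M \<epsilon> P =
     {P' \<in> space (prob_algebra M). \<exists>R\<in>space (prob_algebra M).
        \<forall>A\<in>sets M. measure P' A = (1 - \<epsilon>) * measure P A + \<epsilon> * measure R A}"

text \<open>Laws of the first \<open>k\<close> observations; the factors may differ from agent to agent.\<close>

definition product_class :: "nat \<Rightarrow> 'a measure set \<Rightarrow> (nat \<Rightarrow> 'a) measure set" where
  "product_class k C = {PiM {1..k} P | P. \<forall>j\<in>{1..k}. P j \<in> C}"

text \<open>
  A randomized rule maps what the agent sees to the conditional law of its decision.
\<close>

type_synonym 'a first_rule = "'a \<Rightarrow> bool pmf"
type_synonym 'a rule = "'a \<Rightarrow> bool \<Rightarrow> bool pmf"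

definition is_first_rule :: "'a measure \<Rightarrow> 'a first_rule \<Rightarrow> bool" where
  "is_first_rule M \<phi>1 \<longleftrightarrow> (\<forall>b. (\<lambda>y. pmf (\<phi>1 y) b) \<in> borel_measurable M)"

definition is_rule :: "'a measure \<Rightarrow> 'a rule \<Rightarrow> bool" where
  "is_rule M \<phi> \<longleftrightarrow> (\<forall>u b. (\<lambda>y. pmf (\<phi> y u) b) \<in> borel_measurable M)"

text \<open>
  Conditional law of the decision of agent \<open>k\<close> given the observations \<open>y 1, \<dots>, y k\<close>. The monadic
  bind expresses that the agents randomize independently. Agents are numbered from 1;
  the value for \<open>k = 0\<close> is unspecified and never matters in a limit.
\<close>

fun decision :: "'a first_rule \<Rightarrow> 'a rule \<Rightarrow> nat \<Rightarrow> (nat \<Rightarrow> 'a) \<Rightarrow> bool pmf" where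
  "decision \<phi>1 \<phi> (Suc 0) y = \<phi>1 (y 1)"
| "decision \<phi>1 \<phi> (Suc (Suc k)) y =
     bind_pmf (decision \<phi>1 \<phi> (Suc k) y) (\<lambda>u. \<phi> (y (Suc (Suc k))) u)"

definition decision_prob ::
  "'a first_rule \<Rightarrow> 'a rule \<Rightarrow> nat \<Rightarrow> (nat \<Rightarrow> 'a) measure \<Rightarrow> bool \<Rightarrow> real" where
  "decision_prob \<phi>1 \<phi> k L b = (\<integral>y. pmf (decision \<phi>1 \<phi> k y) b \<partial>L)"

definition error_prob ::
  "real \<Rightarrow> real \<Rightarrow> nat \<Rightarrow> 'a first_rule \<Rightarrow> 'a rule \<Rightarrow>
   (nat \<Rightarrow> 'a) measure \<Rightarrow> (nat \<Rightarrow> 'a) measure \<Rightarrow> real" where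
  "error_prob \<pi>0 \<pi>1 k \<phi>1 \<phi> L0 L1 =
     \<pi>0 * decision_prob \<phi>1 \<phi> k L0 True + \<pi>1 * decision_prob \<phi>1 \<phi> k L1 False"

definition worst_error_prob ::
  "real \<Rightarrow> real \<Rightarrow> 'a measure set \<Rightarrow> 'a measure set \<Rightarrow> nat \<Rightarrow> 'a first_rule \<Rightarrow> 'a rule \<Rightarrow> real" where
  "worst_error_prob \<pi>0 \<pi>1 C0 C1 k \<phi>1 \<phi> =
     (SUP (L0, L1)\<in>product_class k C0 \<times> product_class k C1. error_prob \<pi>0 \<pi>1 k \<phi>1 \<phi> L0 L1)"

text \<open>
  The rules whose asymptotic worst-case error probability is well defined: the limit exists
  and does not depend on the rule of the first agent. (Copying and inverting the previous
  decision are examples of rules for which this fails.)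
\<close>

definition admissible_rules ::
  "'a measure \<Rightarrow> real \<Rightarrow> real \<Rightarrow> 'a measure set \<Rightarrow> 'a measure set \<Rightarrow> 'a rule set" where
  "admissible_rules M \<pi>0 \<pi>1 C0 C1 =
     {\<phi>. is_rule M \<phi> \<and>
        (\<exists>L. \<forall>\<phi>1. is_first_rule M \<phi>1 \<longrightarrow>
           (\<lambda>k. worst_error_prob \<pi>0 \<pi>1 C0 C1 k \<phi>1 \<phi>) \<longlonglongrightarrow> L)}"

text \<open>
  Densities of the least favorable distributions. All divisions are in \<open>ennreal\<close>, where
  \<open>x / 0 = \<infinity>\<close> for \<open>x > 0\<close>, \<open>0 / 0 = 0\<close> and \<open>x / \<infinity> = 0\<close>.
\<close>

definition lfd_density0 ::
  "real \<Rightarrow> ('a \<Rightarrow> ennreal) \<Rightarrow> ('a \<Rightarrow> ennreal) \<Rightarrow> ennreal \<Rightarrow> 'a \<Rightarrow> ennreal" where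
  "lfd_density0 \<epsilon>0 p0 p1 c'' y =
     (if p1 y / p0 y < c'' then ennreal (1 - \<epsilon>0) * p0 y else ennreal (1 - \<epsilon>0) * p1 y / c'')"

definition lfd_density1 ::
  "real \<Rightarrow> ('a \<Rightarrow> ennreal) \<Rightarrow> ('a \<Rightarrow> ennreal) \<Rightarrow> ennreal \<Rightarrow> 'a \<Rightarrow> ennreal" where
  "lfd_density1 \<epsilon>1 p0 p1 c' y =
     (if p1 y / p0 y > c' then ennreal (1 - \<epsilon>1) * p1 y else c' * ennreal (1 - \<epsilon>1) * p0 y)"

text \<open>
  In \<open>lr_test\<close>, the outcome \<open>True\<close> of \<open>bernoulli_pmf p\<close> (of \<open>bernoulli_pmf q\<close>) selects
  decision 0 (the previous decision).
\<close>

definition lr_test ::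
  "('a \<Rightarrow> ennreal) \<Rightarrow> ereal \<Rightarrow> ereal \<Rightarrow> real \<Rightarrow> real \<Rightarrow> 'a rule" where
  "lr_test l t1 t0 p q y u =
     (if enn2ereal (l y) < t1 then return_pmf False
      else if enn2ereal (l y) = t1 then map_pmf (\<lambda>z. if z then False else u) (bernoulli_pmf p)
      else if enn2ereal (l y) < t0 then return_pmf u
      else if enn2ereal (l y) = t0 then map_pmf (\<lambda>z. if z then u else True) (bernoulli_pmf q)
      else return_pmf True)"

definition is_randomized_lrt :: "('a \<Rightarrow> ennreal) \<Rightarrow> 'a rule \<Rightarrow> bool" where
  "is_randomized_lrt l \<phi> \<longleftrightarrow>
     (\<exists>t1 t0. \<exists>p\<in>{0..1}. \<exists>q\<in>{0..1}. \<phi> = lr_test l t1 t0 p q)"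

end

theory Submission
  imports Defs
begin

text \<open>
  For independent observations with a common law, the probability that agent \<open>k\<close> decides 1
  evolves by an affine map, the transition of a two-state Markov chain.

  For the upper bound, a monotone likelihood ratio test depends monotonically on \<open>l\<close> and on the
  previous decision. Where \<open>l\<close> is below its clipping value, \<open>q0\<close> equals \<open>(1 - \<epsilon>0) p0\<close>, the
  least mass any member of the class can have there; hence \<open>Q0\<close> is stochastically extremal, and
  likewise \<open>Q1\<close>. Dominance propagates along the chain, and unless the test copies the previous
  decision almost surely, the chain forgets its start, so that the worst case tends to the error
  under the least favorable pair. If the optimal test does copy, its error is that of the first
  agent, and the memoryless Bayes test does at least as well and is admissible.

  For the lower bound, a rule whose chain is periodic under the least favorable pair is not among
  the competitors in the optimality hypothesis; its lazy version is, and has the averages of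
  consecutive errors as limit.
\<close>

subsection \<open>Two-state chains\<close>

definition trans_prob :: "'a rule \<Rightarrow> 'a measure \<Rightarrow> bool \<Rightarrow> real" where
  "trans_prob \<phi> P u = (\<integral>y. pmf (\<phi> y u) True \<partial>P)"

text \<open>One step of a two-state chain: \<open>x\<close> is the probability of state 1 before the
  step, \<open>a\<close> and \<open>b\<close> are the probabilities of moving to state 1 from states
  0 and 1. As a function of \<open>x\<close> it is affine with slope \<open>b - a\<close>.\<close>

definition markov_step :: "real \<Rightarrow> real \<Rightarrow> real \<Rightarrow> real" where
  "markov_step a b x = (1 - x) * a + x * b"

lemma pmf_False_eq: "pmf p False = 1 - pmf p True"
proof -
  have "(\<Sum>b\<in>UNIV. pmf p b) = 1"
    by (rule sum_pmf_eq_1) auto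
  then show ?thesis by (simp add: UNIV_bool)
qed

lemma pmf_bind_bool:
  "pmf (bind_pmf p f) b = pmf p True * pmf (f True) b + (1 - pmf p True) * pmf (f False) b"
  for p :: "bool pmf"
proof -
  have "pmf (bind_pmf p f) b = (\<Sum>u\<in>UNIV. pmf (f u) b * pmf p u)"
    unfolding pmf_bind by (rule integral_measure_pmf_real) auto
  then show ?thesis by (simp add: UNIV_bool pmf_False_eq)
qed

lemma markov_step_diff: "markov_step a b x - markov_step a b y = (b - a) * (x - y)"
  by (simp add: markov_step_def algebra_simps)

lemma markov_step_bounds:
  assumes "0 \<le> a" "a \<le> 1" "0 \<le> b" "b \<le> 1" "0 \<le> x" "x \<le> 1"
  shows "0 \<le> markov_step a b x" "markov_step a b x \<le> 1"
  using assms convex_bound_le[of a 1 b "1 - x" x]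
  by (auto simp: markov_step_def mult.commute)

text \<open>The coefficients are raised first, at fixed \<open>x\<close> in the unit interval, and
  then \<open>x\<close> itself; the second move uses that the upper map has nonnegative
  slope.\<close>

lemma markov_step_mono:
  assumes "a \<le> a'" "b \<le> b'" "a' \<le> b'" "0 \<le> x" "x \<le> 1" "x \<le> x'"
  shows "markov_step a b x \<le> markov_step a' b' x'"
proof -
  have "markov_step a b x \<le> markov_step a' b' x"
    unfolding markov_step_def using assms by (intro add_mono mult_left_mono) auto
  also have "markov_step a' b' x \<le> markov_step a' b' x'"
  proof -
    have "0 \<le> (b' - a') * (x' - x)" using assms by simp
    then show ?thesis unfolding markov_step_diff[of a' b' x' x, symmetric] by simp
  qed
  finally show ?thesis .
qed

text \<open>Measured from a fixed point, the affine map is multiplication by its slope.\<close>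

lemma markov_funpow_diff_fixpoint:
  assumes "markov_step a b s = s"
  shows "(markov_step a b ^^ n) x - s = (b - a) ^ n * (x - s)"
proof (induction n)
  case (Suc n)
  have "(markov_step a b ^^ Suc n) x - s = markov_step a b ((markov_step a b ^^ n) x) - markov_step a b s"
    using assms by simp
  also have "\<dots> = (b - a) ^ Suc n * (x - s)"
    unfolding markov_step_diff Suc by simp
  finally show ?case .
qed simp

text \<open>The stationary probability of state 1, obtained by solving
  \<open>x = a + (b - a) * x\<close>; slope 1 is the case in which this equation
  degenerates.\<close>

lemma markov_step_fixpoint:
  assumes "b - a \<noteq> 1"
  shows "markov_step a b (a / (1 - (b - a))) = a / (1 - (b - a))"
proof -
  define s where "s = a / (1 - (b - a))"
  have "s * (1 - (b - a)) = a" using assms by (simp add: s_def)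
  then have "markov_step a b s = s" by (simp add: markov_step_def algebra_simps)
  then show ?thesis unfolding s_def .
qed

lemma markov_funpow_tendsto:
  assumes "\<bar>b - a\<bar> < 1"
  shows "(\<lambda>n. (markov_step a b ^^ n) x) \<longlonglongrightarrow> a / (1 - (b - a))"
proof -
  let ?s = "a / (1 - (b - a))"
  have "markov_step a b ?s = ?s" using assms by (intro markov_step_fixpoint) auto
  note * = markov_funpow_diff_fixpoint[OF this]
  have "(\<lambda>n. (b - a) ^ n * (x - ?s)) \<longlonglongrightarrow> 0 * (x - ?s)"
    using assms by (intro tendsto_mult LIMSEQ_power_zero tendsto_const) auto
  then have "(\<lambda>n. (markov_step a b ^^ n) x - ?s) \<longlonglongrightarrow> 0"
    unfolding * by simp
  then show ?thesis by (simp add: LIM_zero_iff)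
qed

text \<open>Mixing the chain with the identity in equal parts turns the slope \<open>b - a\<close>
  into half of \<open>1 + (b - a)\<close>, which is never negative, and keeps the fixed points.
  Averaging two consecutive iterates removes the oscillation from the original chain, so both
  procedures have the same limit.\<close>

lemma lazy_markov_tendsto:
  assumes ab: "0 \<le> a" "a \<le> 1" "0 \<le> b" "b \<le> 1"
  obtains L where "(\<lambda>n. (markov_step (a / 2) ((b + 1) / 2) ^^ n) x) \<longlonglongrightarrow> L"
    and "(\<lambda>n. ((markov_step a b ^^ n) x + (markov_step a b ^^ Suc n) x) / 2) \<longlonglongrightarrow> L"
proof -
  \<comment> \<open>Slope 1 forces the identity and slope -1 the flip; otherwise both maps contract
    to a common stationary value.\<close>
  consider "b - a = 1" | "b - a = - 1" | "\<bar>b - a\<bar> < 1" using ab by linarith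
  then show ?thesis
  proof cases
    case 1
    then have "a = 0" "b = 1" using ab by auto
    moreover have "markov_step 0 1 = id" by (auto simp: markov_step_def)
    ultimately show ?thesis using that[of x] by simp
  next
    case 2
    then have *: "a = 1" "b = 0" using ab by auto
    have "(markov_step 1 0 ^^ Suc n) x = 1 - (markov_step 1 0 ^^ n) x" for n
      by (simp add: markov_step_def)
    then have "(\<lambda>n. ((markov_step 1 0 ^^ n) x + (markov_step 1 0 ^^ Suc n) x) / 2) \<longlonglongrightarrow> 1 / 2"
      by (simp del: funpow.simps)
    moreover have "(\<lambda>n. (markov_step (1/2) (1/2) ^^ n) x) \<longlonglongrightarrow> 1/2"
      using markov_funpow_tendsto[of "1/2" "1/2" x] by simp
    ultimately show ?thesis using that[of "1/2"] unfolding * by (simp del: funpow.simps)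
  next
    case 3
    have "a / 2 / (1 - ((b + 1) / 2 - a / 2)) = a / (1 - (b - a))"
      using 3 by (simp add: field_simps)
    moreover have "\<bar>(b + 1) / 2 - a / 2\<bar> < 1" using 3 ab by (auto simp: abs_if field_simps split: if_splits)
    ultimately have "(\<lambda>n. (markov_step (a / 2) ((b + 1) / 2) ^^ n) x) \<longlonglongrightarrow> a / (1 - (b - a))"
      by (metis markov_funpow_tendsto)
    moreover have *: "(\<lambda>n. (markov_step a b ^^ n) x) \<longlonglongrightarrow> a / (1 - (b - a))"
      by (rule markov_funpow_tendsto[OF 3])
    have "(\<lambda>n. ((markov_step a b ^^ n) x + (markov_step a b ^^ Suc n) x) / 2)
      \<longlonglongrightarrow> (a / (1 - (b - a)) + a / (1 - (b - a))) / 2"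
      by (intro tendsto_intros * LIMSEQ_Suc[OF *]) simp
    moreover have "(s + s) / 2 = s" for s :: real by simp
    ultimately show ?thesis using that by (simp only:)
  qed
qed

section \<open>Decision probabilities as iterates of two-state chains\<close>

lemma decision_cong:
  assumes "\<And>j. 1 \<le> j \<Longrightarrow> j \<le> Suc k \<Longrightarrow> x j = y j"
  shows "decision \<phi>1 \<phi> (Suc k) x = decision \<phi>1 \<phi> (Suc k) y"
  using assms by (induction k) auto

text \<open>The index set \<open>K\<close> may exceed \<open>{1..Suc k}\<close> because the
  induction lowers \<open>k\<close> while the product space stays fixed.\<close>

lemma measurable_decision:
  assumes "is_first_rule M \<phi>1" "is_rule M \<phi>" "{1..Suc k} \<subseteq> K"
  shows "(\<lambda>y. pmf (decision \<phi>1 \<phi> (Suc k) y) b) \<in> borel_measurable (PiM K (\<lambda>_. M))"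
  using assms(3)
proof (induction k arbitrary: b)
  case 0
  have [measurable]: "(\<lambda>y. pmf (\<phi>1 y) b) \<in> borel_measurable M"
    using assms(1) by (auto simp: is_first_rule_def)
  have [measurable]: "(\<lambda>y. y 1) \<in> measurable (PiM K (\<lambda>_. M)) M"
    using 0 by (intro measurable_component_singleton) auto
  show ?case by (simp del: One_nat_def)
next
  case (Suc k)
  have [measurable]: "(\<lambda>y. pmf (\<phi> y u) b) \<in> borel_measurable M" for u b
    using assms(2) by (auto simp: is_rule_def)
  have [measurable]: "(\<lambda>y. y (Suc (Suc k))) \<in> measurable (PiM K (\<lambda>_. M)) M"
    using Suc by (intro measurable_component_singleton) auto
  have [measurable]: "(\<lambda>y. pmf (decision \<phi>1 \<phi> (Suc k) y) b) \<in> borel_measurable (PiM K (\<lambda>_. M))" for b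
    using Suc.prems by (intro Suc.IH) (auto simp: subset_eq)
  show ?case by (simp add: pmf_bind_bool)
qed

lemma integrable_decision:
  assumes "is_first_rule M \<phi>1" "is_rule M \<phi>" "{1..Suc k} \<subseteq> K" "\<And>j. j \<in> K \<Longrightarrow> P j \<in> space (prob_algebra M)"
  shows "integrable (PiM K P) (\<lambda>y. pmf (decision \<phi>1 \<phi> (Suc k) y) b)"
proof -
  have P: "\<And>j. j \<in> K \<Longrightarrow> prob_space (P j)" "\<And>j. j \<in> K \<Longrightarrow> sets (P j) = sets M"
    using assms(4) by (auto simp: space_prob_algebra)
  interpret prob_space "PiM K P" by (intro prob_space_PiM P)
  have "sets (PiM K P) = sets (PiM K (\<lambda>_. M))" using P by (intro sets_PiM_cong) auto
  then have [measurable]: "(\<lambda>y. pmf (decision \<phi>1 \<phi> (Suc k) y) b) \<in> borel_measurable (PiM K P)"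
    using measurable_decision[OF assms(1-3)] by (simp cong: measurable_cong_sets)
  show ?thesis by (rule integrable_const_bound[where B = 1]) (auto simp: pmf_le_1)
qed

lemma integrable_rule:
  assumes "is_rule M \<phi>" "P \<in> space (prob_algebra M)"
  shows "integrable P (\<lambda>y. pmf (\<phi> y u) b)"
proof -
  interpret prob_space P using assms by (auto simp: space_prob_algebra)
  have [measurable]: "(\<lambda>y. pmf (\<phi> y u) b) \<in> borel_measurable P"
    using assms by (auto simp: space_prob_algebra is_rule_def cong: measurable_cong_sets)
  show ?thesis by (rule integrable_const_bound[where B = 1]) (auto simp: pmf_le_1)
qed

lemma trans_prob_bounds:
  assumes "is_rule M \<phi>" "P \<in> space (prob_algebra M)"
  shows "0 \<le> trans_prob \<phi> P u" "trans_prob \<phi> P u \<le> 1"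
proof -
  interpret prob_space P using assms by (auto simp: space_prob_algebra)
  show "0 \<le> trans_prob \<phi> P u" by (simp add: trans_prob_def)
  show "trans_prob \<phi> P u \<le> 1" unfolding trans_prob_def
    using integrable_rule[OF assms] by (intro integral_le_const) (auto simp: pmf_le_1)
qed

lemma decision_prob_bounds:
  assumes "is_first_rule M \<phi>1" "is_rule M \<phi>" "\<And>j. j \<in> {1..Suc k} \<Longrightarrow> P j \<in> space (prob_algebra M)"
  shows "0 \<le> decision_prob \<phi>1 \<phi> (Suc k) (PiM {1..Suc k} P) b"
    "decision_prob \<phi>1 \<phi> (Suc k) (PiM {1..Suc k} P) b \<le> 1"
proof -
  interpret prob_space "PiM {1..Suc k} P"
    using assms(3) by (intro prob_space_PiM) (auto simp: space_prob_algebra)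
  show "0 \<le> decision_prob \<phi>1 \<phi> (Suc k) (PiM {1..Suc k} P) b" by (simp add: decision_prob_def)
  show "decision_prob \<phi>1 \<phi> (Suc k) (PiM {1..Suc k} P) b \<le> 1" unfolding decision_prob_def
    by (intro integral_le_const integrable_decision[OF assms(1,2) order_refl assms(3)])
      (auto simp: pmf_le_1)
qed

lemma decision_prob_False:
  assumes "is_first_rule M \<phi>1" "is_rule M \<phi>" "\<And>j. j \<in> {1..Suc k} \<Longrightarrow> P j \<in> space (prob_algebra M)"
  shows "decision_prob \<phi>1 \<phi> (Suc k) (PiM {1..Suc k} P) False =
    1 - decision_prob \<phi>1 \<phi> (Suc k) (PiM {1..Suc k} P) True"
proof -
  interpret prob_space "PiM {1..Suc k} P"
    using assms(3) by (intro prob_space_PiM) (auto simp: space_prob_algebra)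
  have "integrable (PiM {1..Suc k} P) (\<lambda>y. pmf (decision \<phi>1 \<phi> (Suc k) y) True)"
    by (rule integrable_decision[OF assms(1,2) order_refl assms(3)])
  then show ?thesis unfolding decision_prob_def pmf_False_eq
    by (subst Bochner_Integration.integral_diff) (simp_all add: prob_space del: One_nat_def)
qed

lemma decision_prob_first:
  assumes "is_first_rule M \<phi>1" "P 1 \<in> space (prob_algebra M)"
  shows "decision_prob \<phi>1 \<phi> (Suc 0) (PiM {1..Suc 0} P) b = (\<integral>y. pmf (\<phi>1 y) b \<partial>P 1)"
proof -
  have meas: "(\<lambda>y. pmf (\<phi>1 y) b) \<in> borel_measurable (P 1)"
    using assms by (auto simp: space_prob_algebra is_first_rule_def cong: measurable_cong_sets)
  interpret product_prob_space "\<lambda>_. P 1" "{1::nat}"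
    using assms by (auto simp: space_prob_algebra product_prob_space_def product_prob_space_axioms_def
        product_sigma_finite_def prob_space_imp_sigma_finite)
  have "PiM {1..Suc 0} P = PiM {1::nat} (\<lambda>_. P 1)" by (intro PiM_cong) auto
  then show ?thesis
    using product_integral_singleton[OF meas, of 1] by (simp add: decision_prob_def)
qed

text \<open>Fubini: the last observation is independent of the earlier ones, and the preceding
  decision depends on those alone. Integrating the last observation out leaves one step of a
  two-state chain, whose coefficients may vary from agent to agent.\<close>

lemma decision_prob_step:
  assumes \<phi>1: "is_first_rule M \<phi>1" and \<phi>: "is_rule M \<phi>"
    and P: "\<And>j. j \<in> {1..Suc (Suc k)} \<Longrightarrow> P j \<in> space (prob_algebra M)"
  shows "decision_prob \<phi>1 \<phi> (Suc (Suc k)) (PiM {1..Suc (Suc k)} P) True =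
    markov_step (trans_prob \<phi> (P (Suc (Suc k))) False) (trans_prob \<phi> (P (Suc (Suc k))) True)
      (decision_prob \<phi>1 \<phi> (Suc k) (PiM {1..Suc k} P) True)"
proof -
  let ?n = "Suc (Suc k)"
  let ?d = "\<lambda>y. pmf (decision \<phi>1 \<phi> (Suc k) y) True"
  \<comment> \<open>The product locale wants a probability measure at every index, so the family is
    extended by \<open>P 1\<close> outside the range.\<close>
  define P' where "P' j = (if j \<in> {1..?n} then P j else P 1)" for j
  have P': "P' j \<in> space (prob_algebra M)" for j using P by (auto simp: P'_def)
  interpret product_prob_space P' "{1..?n}"
    using P' by (auto simp: space_prob_algebra product_prob_space_def product_prob_space_axioms_def
        product_sigma_finite_def prob_space_imp_sigma_finite)
  have eq: "PiM {1..?n} P = PiM (insert ?n {1..Suc k}) P'" "PiM {1..Suc k} P = PiM {1..Suc k} P'"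
    by (auto intro!: PiM_cong simp: P'_def)
  interpret N: prob_space "P' ?n" using P' by (auto simp: space_prob_algebra)
  interpret K: prob_space "PiM {1..Suc k} P'"
    using P' by (intro prob_space_PiM) (auto simp: space_prob_algebra)
  have int: "integrable (PiM (insert ?n {1..Suc k}) P') (\<lambda>y. pmf (decision \<phi>1 \<phi> ?n y) True)"
    by (rule integrable_decision[OF \<phi>1 \<phi> _ P']) auto
  have [simp]: "decision \<phi>1 \<phi> (Suc k) (x(?n := z)) = decision \<phi>1 \<phi> (Suc k) x" for x z
    by (rule decision_cong) auto
  note [simp] = integrable_rule[OF \<phi> P']
  have int_d: "integrable (PiM {1..Suc k} P') ?d"
    by (rule integrable_decision[OF \<phi>1 \<phi> order_refl P'])
  have "decision_prob \<phi>1 \<phi> ?n (PiM {1..?n} P) True =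
      (\<integral>x. \<integral>z. pmf (decision \<phi>1 \<phi> ?n (x(?n := z))) True \<partial>P' ?n \<partial>PiM {1..Suc k} P')"
    unfolding decision_prob_def eq by (rule product_integral_insert[OF _ _ int]) auto
  also have "\<dots> = (\<integral>x. ?d x * trans_prob \<phi> (P' ?n) True + (1 - ?d x) * trans_prob \<phi> (P' ?n) False \<partial>PiM {1..Suc k} P')"
    by (simp add: pmf_bind_bool trans_prob_def)
  also have "\<dots> = (\<integral>x. ?d x \<partial>PiM {1..Suc k} P') * trans_prob \<phi> (P' ?n) True +
       (1 - (\<integral>x. ?d x \<partial>PiM {1..Suc k} P')) * trans_prob \<phi> (P' ?n) False"
    using int_d by (simp add: K.prob_space del: One_nat_def)
  finally show ?thesis
    unfolding eq(2) by (simp add: decision_prob_def markov_step_def P'_def)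
qed

text \<open>Agent 1 supplies the starting value, so agent \<open>Suc k\<close> is reached after
  \<open>k\<close> transitions.\<close>

lemma decision_prob_funpow:
  assumes "is_first_rule M \<phi>1" "is_rule M \<phi>" "Q \<in> space (prob_algebra M)"
  shows "decision_prob \<phi>1 \<phi> (Suc k) (PiM {1..Suc k} (\<lambda>_. Q)) True =
    (markov_step (trans_prob \<phi> Q False) (trans_prob \<phi> Q True) ^^ k) (\<integral>y. pmf (\<phi>1 y) True \<partial>Q)"
proof (induction k)
  case 0
  then show ?case using decision_prob_first[of M \<phi>1 "\<lambda>_. Q"] assms by simp
next
  case (Suc k)
  then show ?case using decision_prob_step[of M \<phi>1 \<phi> k "\<lambda>_. Q"] assms by simp
qed

lemma error_prob_eq:
  assumes "is_first_rule M \<phi>1" "is_rule M \<phi>"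
    "\<And>j. j \<in> {1..Suc k} \<Longrightarrow> R0 j \<in> space (prob_algebra M)"
    "\<And>j. j \<in> {1..Suc k} \<Longrightarrow> R1 j \<in> space (prob_algebra M)"
  shows "error_prob \<pi>0 \<pi>1 (Suc k) \<phi>1 \<phi> (PiM {1..Suc k} R0) (PiM {1..Suc k} R1) =
    \<pi>0 * decision_prob \<phi>1 \<phi> (Suc k) (PiM {1..Suc k} R0) True +
    \<pi>1 * (1 - decision_prob \<phi>1 \<phi> (Suc k) (PiM {1..Suc k} R1) True)"
  unfolding error_prob_def using decision_prob_False[OF assms(1,2,4)] by simp

subsection \<open>Contamination classes\<close>

text \<open>Every member of the class dominates the measure \<open>(1 - \<epsilon>) * P0\<close>
  setwise, and integrals of nonnegative functions are monotone in the measure.\<close>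

lemma contamination_nn_integral_le:
  assumes P: "P \<in> contamination_class M \<epsilon> P0" and P0: "P0 \<in> space (prob_algebra M)"
    and \<epsilon>: "0 \<le> \<epsilon>" "\<epsilon> < 1" and f: "f \<in> borel_measurable M"
  shows "ennreal (1 - \<epsilon>) * (\<integral>\<^sup>+y. f y \<partial>P0) \<le> (\<integral>\<^sup>+y. f y \<partial>P)"
proof -
  have sets: "sets P0 = sets M" "sets P = sets M"
    using P P0 by (auto simp: contamination_class_def space_prob_algebra)
  interpret P0: prob_space P0 using P0 by (auto simp: space_prob_algebra)
  interpret P: prob_space P using P by (auto simp: contamination_class_def space_prob_algebra)
  have "scale_measure (ennreal (1 - \<epsilon>)) P0 \<le> P"
  proof (subst le_measure, safe)
    fix A assume "A \<in> sets (scale_measure (ennreal (1 - \<epsilon>)) P0)"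
    then have "A \<in> sets M" using sets by simp
    then have "(1 - \<epsilon>) * measure P0 A \<le> measure P A"
      using P \<epsilon> by (auto simp: contamination_class_def)
    then show "emeasure (scale_measure (ennreal (1 - \<epsilon>)) P0) A \<le> emeasure P A"
      using \<epsilon> by (simp add: P0.emeasure_eq_measure P.emeasure_eq_measure ennreal_mult[symmetric])
  qed (simp_all add: sets)
  then have "(\<integral>\<^sup>+y. f y \<partial>scale_measure (ennreal (1 - \<epsilon>)) P0) \<le> (\<integral>\<^sup>+y. f y \<partial>P)"
    by (intro nn_integral_mono_measure) (simp_all add: sets)
  then show ?thesis
    using f sets by (subst (asm) nn_integral_scale_measure) (auto cong: measurable_cong_sets)
qed
text \<open>The function \<open>G - h\<close> is nonnegative and vanishes wherever \<open>q\<close>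
  differs from \<open>(1 - \<epsilon>) * p\<close>, so under \<open>Q\<close> it is integrated only
  against the part that all members of the class share. No member gives it a smaller integral, hence
  none gives \<open>h\<close> a larger one.\<close>

lemma contamination_integral_le:
  fixes h :: "'a \<Rightarrow> real"
  assumes P: "P \<in> contamination_class M \<epsilon> P0"
    and P0: "P0 \<in> space (prob_algebra M)" "P0 = density M p" "p \<in> borel_measurable M"
    and Q: "prob_space Q" "Q = density M q" "q \<in> borel_measurable M"
    and \<epsilon>: "0 \<le> \<epsilon>" "\<epsilon> < 1"
    and h: "h \<in> borel_measurable M" "\<And>y. \<bar>h y\<bar> \<le> 1"
    and extremal: "AE y in M. q y = ennreal (1 - \<epsilon>) * p y \<or> h y = G"
    and max: "AE y in P. h y \<le> G" "AE y in Q. h y \<le> G"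
  shows "(\<integral>y. h y \<partial>P) \<le> (\<integral>y. h y \<partial>Q)"
proof -
  have sets: "sets P = sets M" and "prob_space P"
    using P by (auto simp: contamination_class_def space_prob_algebra)
  interpret P: prob_space P by fact
  interpret Q: prob_space Q by fact
  note [measurable] = h(1) P0(3) Q(3)
  \<comment> \<open>As \<open>h \<le> G\<close> is known only almost everywhere, the positive part
    provides a function that is nonnegative everywhere and agrees with \<open>G - h\<close> almost
    everywhere under both laws.\<close>
  define f where "f y = max 0 (G - h y)" for y
  have meas: "f \<in> borel_measurable M" unfolding f_def by measurable
  note [measurable] = meas
  have f0: "0 \<le> f y" and f1: "f y \<le> \<bar>G\<bar> + 1" for y
    using h(2)[of y] by (auto simp: f_def)
  have measP: "f \<in> borel_measurable P" "h \<in> borel_measurable P"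
    and measQ: "f \<in> borel_measurable Q" "h \<in> borel_measurable Q"
    using meas h(1) sets Q(2) by (auto cong: measurable_cong_sets)
  have int: "integrable P f" "integrable Q f" "integrable P h" "integrable Q h"
    using f0 f1 h(2) measP measQ
    by (simp_all add: P.integrable_const_bound[where B = "\<bar>G\<bar> + 1"] Q.integrable_const_bound[where B = "\<bar>G\<bar> + 1"]
        P.integrable_const_bound[where B = 1] Q.integrable_const_bound[where B = 1])
  have "(\<integral>\<^sup>+y. f y \<partial>Q) = (\<integral>\<^sup>+y. q y * f y \<partial>M)"
    unfolding Q(2) by (rule nn_integral_density) auto
  also have "\<dots> = (\<integral>\<^sup>+y. ennreal (1 - \<epsilon>) * (p y * f y) \<partial>M)"
    using extremal by (intro nn_integral_cong_AE) (auto elim!: eventually_mono simp: f_def mult.assoc)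
  also have "\<dots> = ennreal (1 - \<epsilon>) * (\<integral>\<^sup>+y. f y \<partial>P0)"
    unfolding P0(2) by (subst nn_integral_density) (auto simp: nn_integral_cmult)
  also have "\<dots> \<le> (\<integral>\<^sup>+y. f y \<partial>P)"
    by (rule contamination_nn_integral_le[OF P P0(1) \<epsilon>]) measurable
  finally have "(\<integral>y. f y \<partial>Q) \<le> (\<integral>y. f y \<partial>P)"
    using int f0 by (simp add: nn_integral_eq_integral)
  moreover have "(\<integral>y. f y \<partial>Q) = (\<integral>y. G - h y \<partial>Q)"
    using max(2) measQ by (intro integral_cong_AE) (auto simp: f_def)
  moreover have "(\<integral>y. f y \<partial>P) = (\<integral>y. G - h y \<partial>P)"
    using max(1) measP by (intro integral_cong_AE) (auto simp: f_def)
  ultimately show ?thesis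
    using int by (simp add: P.prob_space Q.prob_space)
qed

lemma nominal_in_contamination_class:
  "P \<in> space (prob_algebra M) \<Longrightarrow> P \<in> contamination_class M \<epsilon> P"
  by (auto simp: contamination_class_def algebra_simps intro!: bexI[of _ P])

text \<open>The contaminating law is the excess of \<open>q\<close> over
  \<open>(1 - \<epsilon>) * p\<close>, divided by \<open>\<epsilon>\<close>; it has mass one because
  \<open>P\<close> and \<open>Q\<close> do.\<close>

lemma density_in_contamination_class:
  assumes P: "prob_space P" "P = density M p" "p \<in> borel_measurable M"
    and Q: "prob_space Q" "Q = density M q" "q \<in> borel_measurable M"
    and \<epsilon>: "0 \<le> \<epsilon>" "\<epsilon> < 1"
    and le: "AE y in M. ennreal (1 - \<epsilon>) * p y \<le> q y"
  shows "Q \<in> contamination_class M \<epsilon> P"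
proof -
  interpret P: prob_space P by fact
  interpret Q: prob_space Q by fact
  note [measurable] = P(3) Q(3)
  have sets: "sets P = sets M" "sets Q = sets M" using P Q by auto
  have "\<exists>R\<in>space (prob_algebra M). \<forall>A\<in>sets M. measure Q A = (1 - \<epsilon>) * measure P A + \<epsilon> * measure R A"
  proof (cases "\<epsilon> = 0")
    \<comment> \<open>Here there is no excess to normalise. Domination on a set and on its
      complement, with equal total masses, forces \<open>Q\<close> and \<open>P\<close> to
      agree.\<close>
    case True
    have *: "measure P A \<le> measure Q A" if [measurable]: "A \<in> sets M" for A
    proof -
      have "emeasure P A \<le> emeasure Q A"
        unfolding P(2) Q(2) using le True
        by (auto simp: emeasure_density intro!: nn_integral_mono_AE elim!: eventually_mono intro: mult_right_mono)
      then show ?thesis by (simp add: P.emeasure_eq_measure Q.emeasure_eq_measure)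
    qed
    have "measure Q A = measure P A" if "A \<in> sets M" for A
    proof -
      have "space P = space M" "space Q = space M" using sets[THEN sets_eq_imp_space_eq] by auto
      then show ?thesis
        using *[OF that] *[of "space M - A"] P.prob_compl[of A] Q.prob_compl[of A] that sets by auto
    qed
    then show ?thesis using True P.prob_space_axioms sets
      by (intro bexI[of _ P]) (auto simp: space_prob_algebra)
  next
    case False
    then have e: "0 < \<epsilon>" using \<epsilon> by simp
    define R where "R = density M (\<lambda>y. (q y - ennreal (1 - \<epsilon>) * p y) / ennreal \<epsilon>)"
    have R: "emeasure R A = ennreal ((measure Q A - (1 - \<epsilon>) * measure P A) / \<epsilon>)"
      and PQ: "(1 - \<epsilon>) * measure P A \<le> measure Q A"
      if [measurable]: "A \<in> sets M" for A
    proof -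
      have PA: "(\<integral>\<^sup>+y. ennreal (1 - \<epsilon>) * (p y * indicator A y) \<partial>M) = ennreal ((1 - \<epsilon>) * measure P A)"
        using P(2) \<epsilon> P.emeasure_eq_measure[of A]
        by (simp add: nn_integral_cmult emeasure_density ennreal_mult)
      have QA: "(\<integral>\<^sup>+y. q y * indicator A y \<partial>M) = ennreal (measure Q A)"
        using Q(2) Q.emeasure_eq_measure[of A] by (simp add: emeasure_density)
      \<comment> \<open>Subtraction in \<open>ennreal\<close> truncates at 0; this inequality, with
        finite masses, makes the integral of the difference the difference of the integrals.\<close>
      have AE: "AE y in M. ennreal (1 - \<epsilon>) * (p y * indicator A y) \<le> q y * indicator A y"
        using le by (auto elim!: eventually_mono split: split_indicator)
      show "(1 - \<epsilon>) * measure P A \<le> measure Q A"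
        using nn_integral_mono_AE[OF AE] unfolding PA QA by simp
      have "emeasure R A = (\<integral>\<^sup>+y. (q y * indicator A y - ennreal (1 - \<epsilon>) * (p y * indicator A y)) / ennreal \<epsilon> \<partial>M)"
        unfolding R_def by (subst emeasure_density) (auto intro!: nn_integral_cong split: split_indicator)
      also have "\<dots> = (ennreal (measure Q A) - ennreal ((1 - \<epsilon>) * measure P A)) / ennreal \<epsilon>"
        using AE by (simp add: nn_integral_divide nn_integral_diff PA QA)
      also have "\<dots> = ennreal ((measure Q A - (1 - \<epsilon>) * measure P A) / \<epsilon>)"
        using e \<epsilon> \<open>(1 - \<epsilon>) * measure P A \<le> measure Q A\<close>
        by (simp add: ennreal_minus divide_ennreal)
      finally show "emeasure R A = ennreal ((measure Q A - (1 - \<epsilon>) * measure P A) / \<epsilon>)" .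
    qed
    have sp: "space P = space M" "space Q = space M" "space R = space M" "sets R = sets M"
      using sets[THEN sets_eq_imp_space_eq] by (auto simp: R_def)
    have "prob_space R"
      using R[of "space M"] e P.prob_space Q.prob_space sp by (intro prob_spaceI) simp
    moreover have "measure Q A = (1 - \<epsilon>) * measure P A + \<epsilon> * measure R A" if "A \<in> sets M" for A
      using R[OF that] PQ[OF that] e by (simp add: measure_def)
    ultimately show ?thesis using sp by (intro bexI[of _ R]) (auto simp: space_prob_algebra)
  qed
  then show ?thesis using Q.prob_space_axioms sets
    by (auto simp: contamination_class_def space_prob_algebra)
qed

section \<open>Densities of the least favorable pair\<close>

text \<open>Mutual absolute continuity makes the zero sets of the two densities agree up to null
  sets, and total mass one makes the densities finite. Outside the common zero set, quotients in
  \<open>ennreal\<close> then behave as in the reals.\<close>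

lemma mutually_ac_densities:
  assumes P0: "prob_space P0" "P0 = density M p0" "p0 \<in> borel_measurable M"
    and P1: "prob_space P1" "P1 = density M p1" "p1 \<in> borel_measurable M"
    and ac: "absolutely_continuous P0 P1" "absolutely_continuous P1 P0"
  shows "AE y in M. (p0 y = 0 \<and> p1 y = 0) \<or> (\<exists>a>0. \<exists>b>0. p0 y = ennreal a \<and> p1 y = ennreal b)"
proof -
  have sets: "sets P0 = sets M" "sets P1 = sets M" using P0 P1 by auto
  have fin: "AE y in M. p y \<noteq> \<infinity>" if "prob_space (density M p)" "p \<in> borel_measurable M" for p
  proof (rule nn_integral_PInf_AE[OF that(2)])
    interpret prob_space "density M p" by fact
    have "(\<integral>\<^sup>+y. p y \<partial>M) = 1"
      using emeasure_space_1 that(2) by (simp add: emeasure_density cong: nn_integral_cong)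
    then show "(\<integral>\<^sup>+y. p y \<partial>M) \<noteq> \<infinity>" by simp
  qed
  have "AE y in P0. 0 < p0 y" "AE y in P1. 0 < p1 y"
    unfolding P0(2) P1(2) using P0(3) P1(3) by (auto simp: AE_density)
  then have "AE y in P1. 0 < p0 y" "AE y in P0. 0 < p1 y"
    using ac sets by (auto elim!: absolutely_continuous_AE[rotated])
  then have "AE y in M. 0 < p1 y \<longrightarrow> 0 < p0 y" "AE y in M. 0 < p0 y \<longrightarrow> 0 < p1 y"
    unfolding P0(2) P1(2) using P0(3) P1(3) by (auto simp: AE_density)
  moreover have "AE y in M. p0 y \<noteq> \<infinity>" "AE y in M. p1 y \<noteq> \<infinity>"
    using fin P0 P1 by auto
  ultimately show ?thesis
  proof eventually_elim
    case (elim y)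
    show ?case
    proof (cases "p0 y = 0")
      case False
      then have "0 < p0 y" "0 < p1 y" "p0 y = ennreal (enn2real (p0 y))" "p1 y = ennreal (enn2real (p1 y))"
        using elim by (auto simp: zero_less_iff_neq_zero less_top)
      then have "0 < enn2real (p0 y)" "0 < enn2real (p1 y)"
        by (metis ennreal_0 ennreal_enn2real_if ennreal_eq_0_iff less_irrefl not_le)+
      then show ?thesis using \<open>p0 y = ennreal _\<close> \<open>p1 y = ennreal _\<close> by blast
    next
      case True
      then show ?thesis using elim by (auto simp: zero_less_iff_neq_zero)
    qed
  qed
qed

text \<open>Up to the constant \<open>\<beta>\<close>, the ratio \<open>q1 / q0\<close> is the
  nominal ratio clipped to the interval from \<open>c'\<close> to \<open>c''\<close>. A density can
  leave its unavoidable part only where the ratio sits at a clip: \<open>q0\<close> at the upper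
  one, \<open>q1\<close> at the lower one.\<close>

lemma lfd_densities_pointwise:
  fixes c' c'' :: ennreal
  assumes a: "0 < a" "p0 y = ennreal a" and b: "0 < b" "p1 y = ennreal b"
    and \<epsilon>: "\<epsilon>0 < 1" "\<epsilon>1 < 1" and c: "c' < c''"
  defines "q0 \<equiv> lfd_density0 \<epsilon>0 p0 p1 c'' y" and "q1 \<equiv> lfd_density1 \<epsilon>1 p0 p1 c' y"
    and "\<beta> \<equiv> ennreal ((1 - \<epsilon>1) / (1 - \<epsilon>0))"
  shows "0 < q0" "q0 < \<infinity>" "q1 < \<infinity>"
    "ennreal (1 - \<epsilon>0) * p0 y \<le> q0" "ennreal (1 - \<epsilon>1) * p1 y \<le> q1"
    "\<beta> * c' \<le> q1 / q0" "q1 / q0 \<le> \<beta> * c''"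
    "q0 = ennreal (1 - \<epsilon>0) * p0 y \<or> q1 / q0 = \<beta> * c''"
    "q1 = ennreal (1 - \<epsilon>1) * p1 y \<or> q1 / q0 = \<beta> * c'"
proof -
  define r where "r = ennreal (b / a)"
  have r: "p1 y / p0 y = r" using a b by (simp add: r_def divide_ennreal)
  have q0: "q0 = (if r < c'' then ennreal (1 - \<epsilon>0) * ennreal a else ennreal (1 - \<epsilon>0) * ennreal b / c'')"
    and q1: "q1 = (if r > c' then ennreal (1 - \<epsilon>1) * ennreal b else c' * ennreal (1 - \<epsilon>1) * ennreal a)"
    unfolding q0_def q1_def lfd_density0_def lfd_density1_def r by (simp_all add: a b)
  have \<beta>: "0 < (1 - \<epsilon>1) / (1 - \<epsilon>0)" using \<epsilon> by simp
  consider "r \<le> c'" | "c' < r" "r < c''" | "c'' \<le> r" by force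
  then have *: "0 < q0 \<and> q0 < \<infinity> \<and> q1 < \<infinity> \<and> ennreal (1 - \<epsilon>0) * p0 y \<le> q0 \<and> ennreal (1 - \<epsilon>1) * p1 y \<le> q1 \<and>
    q1 / q0 = \<beta> * max c' (min c'' r) \<and> (q0 = ennreal (1 - \<epsilon>0) * p0 y \<or> c'' \<le> r) \<and>
    (q1 = ennreal (1 - \<epsilon>1) * p1 y \<or> r \<le> c')"
  proof cases
    case 1
    \<comment> \<open>The lower clip is finite because it lies strictly below
      \<open>c''\<close>.\<close>
    then obtain s where s: "c' = ennreal s" "0 \<le> s" using c by (cases c') auto
    then have "b / a \<le> s" using 1 a b by (simp add: r_def)
    then have "b \<le> s * a" using a by (simp add: field_simps)
    then have "ennreal ((1 - \<epsilon>1) * b) \<le> ennreal (s * (1 - \<epsilon>1) * a)"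
      using \<epsilon> mult_left_mono[of b "s * a" "1 - \<epsilon>1"] by (intro ennreal_leI) (simp add: ac_simps)
    then have "ennreal (1 - \<epsilon>1) * p1 y \<le> ennreal (s * (1 - \<epsilon>1) * a)"
      using b \<epsilon> by (simp add: ennreal_mult[symmetric])
    moreover have "q0 = ennreal ((1 - \<epsilon>0) * a)" "q1 = ennreal (s * (1 - \<epsilon>1) * a)"
      using 1 c a \<epsilon> s by (auto simp: q0 q1 ennreal_mult)
    moreover from this have "q1 / q0 = \<beta> * c'"
      using a \<epsilon> s \<beta> by (simp add: divide_ennreal \<beta>_def ennreal_mult[symmetric])
    ultimately show ?thesis
      using 1 c a b \<epsilon> by (auto simp: ennreal_mult[symmetric] min_def max_def)
  next
    case 2
    have "q0 = ennreal ((1 - \<epsilon>0) * a)" "q1 = ennreal ((1 - \<epsilon>1) * b)"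
      using 2 a b \<epsilon> by (auto simp: q0 q1 ennreal_mult)
    moreover from this have "q1 / q0 = \<beta> * r"
      using a b \<epsilon> \<beta> by (simp add: divide_ennreal \<beta>_def r_def ennreal_mult[symmetric])
    ultimately show ?thesis
      using 2 a b \<epsilon> by (auto simp: ennreal_mult[symmetric] min_def max_def)
  next
    case 3
    \<comment> \<open>The nominal ratio is real, so an upper clip that it reaches is finite; it is
      positive because \<open>c' < c''\<close>.\<close>
    then obtain s where s: "c'' = ennreal s" "0 \<le> s" by (cases c'') (auto simp: r_def top_unique)
    have "0 < s" using c s by (cases "s = 0") auto
    have "s \<le> b / a" using 3 s a b by (simp add: r_def)
    then have "a \<le> b / s" using a \<open>0 < s\<close> by (simp add: field_simps)
    then have "(1 - \<epsilon>0) * a \<le> (1 - \<epsilon>0) * b / s" using \<epsilon> mult_left_mono[of a "b / s" "1 - \<epsilon>0"] by simp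
    moreover have "q0 = ennreal ((1 - \<epsilon>0) * b / s)" "q1 = ennreal ((1 - \<epsilon>1) * b)"
      using 3 c a b \<epsilon> s \<open>0 < s\<close>
      by (auto simp: q0 q1 ennreal_mult[symmetric] divide_ennreal)
    moreover from this have "q1 / q0 = \<beta> * c''"
      using a b \<epsilon> s \<beta> \<open>0 < s\<close> by (simp add: divide_ennreal \<beta>_def ennreal_mult[symmetric])
    ultimately show ?thesis
      using 3 c a b \<epsilon> \<open>0 < s\<close> by (auto simp: ennreal_mult[symmetric] min_def max_def)
  qed
  then show "0 < q0" "q0 < \<infinity>" "q1 < \<infinity>" "ennreal (1 - \<epsilon>0) * p0 y \<le> q0" "ennreal (1 - \<epsilon>1) * p1 y \<le> q1" by auto
  have clip: "q1 / q0 = \<beta> * max c' (min c'' r)" using * by blast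
  show "\<beta> * c' \<le> q1 / q0" "q1 / q0 \<le> \<beta> * c''"
    unfolding clip using c by (auto intro!: mult_left_mono)
  show "q0 = ennreal (1 - \<epsilon>0) * p0 y \<or> q1 / q0 = \<beta> * c''"
    using * c by (auto simp: min_def max_def)
  show "q1 = ennreal (1 - \<epsilon>1) * p1 y \<or> q1 / q0 = \<beta> * c'"
    using * c by (auto simp: min_def max_def)
qed

lemma lfd_densities_zero:
  assumes "p0 y = 0" "p1 y = 0"
  shows "lfd_density0 \<epsilon>0 p0 p1 c'' y = 0" "lfd_density1 \<epsilon>1 p0 p1 c' y = 0"
  using assms by (auto simp: lfd_density0_def lfd_density1_def)

lemma measurable_lfd_densities:
  assumes [measurable]: "p0 \<in> borel_measurable M" "p1 \<in> borel_measurable M"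
  shows "lfd_density0 \<epsilon>0 p0 p1 c'' \<in> borel_measurable M" "lfd_density1 \<epsilon>1 p0 p1 c' \<in> borel_measurable M"
  unfolding lfd_density0_def[abs_def] lfd_density1_def[abs_def] by measurable

section \<open>Likelihood ratio tests as monotone functions of the ratio\<close>

text \<open>In order of increasing ratio the outcomes are 0, a mixture of 0 and the previous
  decision, the previous decision, a mixture of it and 1, and 1; each is nondecreasing in the
  previous decision. As the cases are read in order, this survives \<open>t0 \<le> t1\<close>, when
  only the first two and the last remain.\<close>

lemma lr_test_mono:
  assumes "p \<in> {0..1}" "q \<in> {0..1}" "l x \<le> l y" "u \<le> v"
  shows "pmf (lr_test l t1 t0 p q x u) True \<le> pmf (lr_test l t1 t0 p q y v) True"
proof -
  have map: "pmf (map_pmf f (bernoulli_pmf s)) True = s * of_bool (f True) + (1 - s) * of_bool (f False)"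
    if "s \<in> {0..1}" for f :: "bool \<Rightarrow> bool" and s
    using that by (simp add: map_pmf_def pmf_bind pmf_return indicator_def)
  have "enn2ereal (l x) \<le> enn2ereal (l y)" using assms by (simp add: less_eq_ennreal.rep_eq)
  then show ?thesis
    using assms(1,2,4) unfolding lr_test_def
    by (cases u; cases v) (auto simp: map)
qed

text \<open>Makes the observation enter only through its ratio, the form to which stochastic
  dominance applies.\<close>

lemma lr_test_ratio: "lr_test l t1 t0 p q y u = lr_test (\<lambda>r. r) t1 t0 p q (l y) u"
  by (simp add: lr_test_def)

text \<open>Equal thresholds leave no copying region and \<open>p = 1\<close> resolves ties to 0, so
  the test is memoryless.\<close>

lemma lr_test_threshold:
  assumes "0 \<le> t"
  shows "lr_test l (ereal t) (ereal t) 1 1 y u = return_pmf (ennreal t < l y)"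
proof -
  have "ennreal t < l y \<longleftrightarrow> ereal t < enn2ereal (l y)"
    using assms by (simp add: less_ennreal.rep_eq)
  moreover have "bernoulli_pmf 1 = return_pmf True"
  proof (rule pmf_eqI)
    show "pmf (bernoulli_pmf 1) b = pmf (return_pmf True) b" for b by (cases b) auto
  qed
  ultimately show ?thesis by (auto simp: lr_test_def)
qed

section \<open>Extremality of the least favorable pair\<close>

locale lfd_pair =
  fixes M P0 P1 :: "'a measure" and p0 p1 :: "'a \<Rightarrow> ennreal" and \<epsilon>0 \<epsilon>1 :: real and c' c'' :: ennreal
    and C0 C1 :: "'a measure set" and q0 q1 :: "'a \<Rightarrow> ennreal" and Q0 Q1 :: "'a measure"
  assumes contamination: "0 \<le> \<epsilon>0" "\<epsilon>0 < 1" "0 \<le> \<epsilon>1" "\<epsilon>1 < 1"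
    and nominal: "P0 \<in> space (prob_algebra M)" "P1 \<in> space (prob_algebra M)"
    and densities: "p0 \<in> borel_measurable M" "P0 = density M p0"
      "p1 \<in> borel_measurable M" "P1 = density M p1"
    and C0_def: "C0 = contamination_class M \<epsilon>0 P0" and C1_def: "C1 = contamination_class M \<epsilon>1 P1"
    and mutually_ac: "\<And>P P'. P \<in> C0 \<union> C1 \<Longrightarrow> P' \<in> C0 \<union> C1 \<Longrightarrow> absolutely_continuous P P'"
    and q0_def: "q0 = lfd_density0 \<epsilon>0 p0 p1 c''" and q1_def: "q1 = lfd_density1 \<epsilon>1 p0 p1 c'"
    and clipping: "c' < c''"
    and lfd: "Q0 = density M q0" "prob_space Q0" "Q1 = density M q1" "prob_space Q1"
begin

abbreviation l :: "'a \<Rightarrow> ennreal" where "l \<equiv> \<lambda>y. q1 y / q0 y"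

text \<open>The points where the ratio can be handled with real arithmetic; their complement is null
  under every member of either class.\<close>

definition regular :: "'a \<Rightarrow> bool" where
  "regular y \<longleftrightarrow> (\<exists>a>0. \<exists>b>0. p0 y = ennreal a \<and> p1 y = ennreal b)"

lemma classes_prob: "C0 \<subseteq> space (prob_algebra M)" "C1 \<subseteq> space (prob_algebra M)"
  by (auto simp: C0_def C1_def contamination_class_def)

lemma nominal_in_classes: "P0 \<in> C0" "P1 \<in> C1"
  using nominal by (auto simp: C0_def C1_def intro: nominal_in_contamination_class)

lemma measurable_q [measurable]: "q0 \<in> borel_measurable M" "q1 \<in> borel_measurable M"
  using measurable_lfd_densities densities by (auto simp: q0_def q1_def)

lemma AE_regular_or_zero: "AE y in M. regular y \<or> p0 y = 0 \<and> p1 y = 0"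
proof -
  have "AE y in M. (p0 y = 0 \<and> p1 y = 0) \<or> (\<exists>a>0. \<exists>b>0. p0 y = ennreal a \<and> p1 y = ennreal b)"
    using nominal densities nominal_in_classes mutually_ac
    by (intro mutually_ac_densities[of P0 _ _ P1]) (auto simp: space_prob_algebra)
  then show ?thesis by eventually_elim (auto simp: regular_def)
qed

text \<open>The densities give the claim under \<open>P0\<close>, and absolute continuity carries it
  to every other member.\<close>

lemma AE_regular:
  assumes "P \<in> C0 \<union> C1"
  shows "AE y in P. regular y"
proof (rule absolutely_continuous_AE)
  show "sets P = sets P0" using assms classes_prob nominal by (auto simp: space_prob_algebra)
  show "absolutely_continuous P0 P" using assms nominal_in_classes mutually_ac by auto
  have "AE y in M. 0 < p0 y \<longrightarrow> regular y" using AE_regular_or_zero by eventually_elim auto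
  then show "AE y in P0. regular y" unfolding densities(2) AE_density[OF densities(1)] .
qed

lemma regular_lfd:
  assumes "regular y"
  defines "\<beta> \<equiv> ennreal ((1 - \<epsilon>1) / (1 - \<epsilon>0))"
  shows "0 < q0 y" "q0 y < \<infinity>" "q1 y < \<infinity>"
    "ennreal (1 - \<epsilon>0) * p0 y \<le> q0 y" "ennreal (1 - \<epsilon>1) * p1 y \<le> q1 y"
    "\<beta> * c' \<le> l y" "l y \<le> \<beta> * c''"
    "q0 y = ennreal (1 - \<epsilon>0) * p0 y \<or> l y = \<beta> * c''"
    "q1 y = ennreal (1 - \<epsilon>1) * p1 y \<or> l y = \<beta> * c'"
proof -
  obtain a b where "0 < a" "p0 y = ennreal a" "0 < b" "p1 y = ennreal b"
    using assms(1) by (auto simp: regular_def)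
  note * = lfd_densities_pointwise[where y = y and ?p0.0 = p0 and ?p1.0 = p1, OF this contamination(2,4) clipping, folded q0_def q1_def \<beta>_def]
  show "0 < q0 y" "q0 y < \<infinity>" "q1 y < \<infinity>"
    "ennreal (1 - \<epsilon>0) * p0 y \<le> q0 y" "ennreal (1 - \<epsilon>1) * p1 y \<le> q1 y"
    "\<beta> * c' \<le> l y" "l y \<le> \<beta> * c''"
    "q0 y = ennreal (1 - \<epsilon>0) * p0 y \<or> l y = \<beta> * c''"
    "q1 y = ennreal (1 - \<epsilon>1) * p1 y \<or> l y = \<beta> * c'"
    by (fact *)+
qed

lemma zero_lfd:
  assumes "p0 y = 0" "p1 y = 0"
  shows "q0 y = 0" "q1 y = 0"
  using lfd_densities_zero[where y = y and ?p0.0 = p0 and ?p1.0 = p1, OF assms] by (auto simp: q0_def q1_def)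

text \<open>Both densities dominate their unavoidable parts. Membership is what makes the error
  under this pair a lower bound for the worst case.\<close>

lemma lfd_in_classes: "Q0 \<in> C0" "Q1 \<in> C1"
proof -
  have "AE y in M. ennreal (1 - \<epsilon>0) * p0 y \<le> q0 y" "AE y in M. ennreal (1 - \<epsilon>1) * p1 y \<le> q1 y"
    using AE_regular_or_zero by (eventually_elim, auto dest: regular_lfd(4,5))+
  then show "Q0 \<in> C0" "Q1 \<in> C1"
    unfolding C0_def C1_def using nominal densities contamination lfd
    by (auto intro!: density_in_contamination_class simp: space_prob_algebra)
qed

text \<open>A monotone function of the ratio is largest at the upper clip, and below that clip
  \<open>q0\<close> is the unavoidable density; so \<open>contamination_integral_le\<close> applies
  with the value at the clip as \<open>G\<close>.\<close>

lemma stochastic_dominance: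
  fixes g :: "ennreal \<Rightarrow> real"
  assumes g: "mono g" "\<And>r. \<bar>g r\<bar> \<le> 1" "(\<lambda>y. g (l y)) \<in> borel_measurable M"
  shows "P \<in> C0 \<Longrightarrow> (\<integral>y. g (l y) \<partial>P) \<le> (\<integral>y. g (l y) \<partial>Q0)"
    and "P \<in> C1 \<Longrightarrow> (\<integral>y. g (l y) \<partial>Q1) \<le> (\<integral>y. g (l y) \<partial>P)"
proof -
  let ?\<beta> = "ennreal ((1 - \<epsilon>1) / (1 - \<epsilon>0))"
  have upper: "AE y in P. g (l y) \<le> g (?\<beta> * c'')" and lower: "AE y in P. - g (l y) \<le> - g (?\<beta> * c')"
    if "P \<in> C0 \<union> C1" for P
    using AE_regular[OF that] regular_lfd(6,7) g(1)
    by (auto elim!: eventually_mono dest: monoD)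
  show "(\<integral>y. g (l y) \<partial>P) \<le> (\<integral>y. g (l y) \<partial>Q0)" if "P \<in> C0"
  proof (rule contamination_integral_le[OF _ nominal(1) densities(2,1) lfd(2,1) measurable_q(1) contamination(1,2) g(3,2)])
    show "AE y in M. q0 y = ennreal (1 - \<epsilon>0) * p0 y \<or> g (l y) = g (?\<beta> * c'')"
      using AE_regular_or_zero by eventually_elim (auto dest: regular_lfd(8) simp: zero_lfd)
    show "AE y in P. g (l y) \<le> g (?\<beta> * c'')" "AE y in Q0. g (l y) \<le> g (?\<beta> * c'')"
      using upper that lfd_in_classes by auto
  qed (use that C0_def in auto)
  show "(\<integral>y. g (l y) \<partial>Q1) \<le> (\<integral>y. g (l y) \<partial>P)" if "P \<in> C1"
  proof -
    \<comment> \<open>The mirrored argument: \<open>- g\<close> is largest at the lower clip, above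
      which \<open>q1\<close> is the unavoidable density.\<close>
    have "(\<integral>y. - g (l y) \<partial>P) \<le> (\<integral>y. - g (l y) \<partial>Q1)"
    proof (rule contamination_integral_le[OF _ nominal(2) densities(4,3) lfd(4,3) measurable_q(2) contamination(3,4)])
      show "AE y in M. q1 y = ennreal (1 - \<epsilon>1) * p1 y \<or> - g (l y) = - g (?\<beta> * c')"
        using AE_regular_or_zero by eventually_elim (auto dest: regular_lfd(9) simp: zero_lfd)
      show "AE y in P. - g (l y) \<le> - g (?\<beta> * c')" "AE y in Q1. - g (l y) \<le> - g (?\<beta> * c')"
        using lower that lfd_in_classes by auto
    qed (use that C1_def g in auto)
    then show ?thesis by simp
  qed
qed

text \<open>The Bayes risk is the integral over \<open>M\<close> of an expression that is affine in
  \<open>h y\<close> at each regular point, minimised by deciding 1 exactly where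
  \<open>\<pi>0 * q0 y < \<pi>1 * q1 y\<close>.\<close>

lemma bayes_threshold_optimal:
  assumes \<pi>: "0 < \<pi>0" "0 < \<pi>1"
    and h: "h \<in> borel_measurable M" "\<And>y. 0 \<le> h y" "\<And>y. h y \<le> 1"
  defines "f \<equiv> \<lambda>y. of_bool (ennreal (\<pi>0 / \<pi>1) < l y)"
  shows "\<pi>0 * (\<integral>y. f y \<partial>Q0) + \<pi>1 * (1 - (\<integral>y. f y \<partial>Q1)) \<le> \<pi>0 * (\<integral>y. h y \<partial>Q0) + \<pi>1 * (1 - (\<integral>y. h y \<partial>Q1))"
proof -
  interpret Q0: prob_space Q0 by (rule lfd(2))
  interpret Q1: prob_space Q1 by (rule lfd(4))
  let ?cost = "\<lambda>h y. q0 y * ennreal (\<pi>0 * h y) + q1 y * ennreal (\<pi>1 * (1 - h y))"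
  have cost: "(\<integral>\<^sup>+y. ?cost h y \<partial>M) = ennreal (\<pi>0 * (\<integral>y. h y \<partial>Q0) + \<pi>1 * (1 - (\<integral>y. h y \<partial>Q1)))"
    if [measurable]: "h \<in> borel_measurable M" and h: "\<And>y. 0 \<le> h y" "\<And>y. h y \<le> 1" for h
  proof -
    have meas: "h \<in> borel_measurable Q0" "h \<in> borel_measurable Q1"
      using lfd that by auto
    have int: "integrable Q0 h" "integrable Q1 h"
      using h meas by (simp_all add: Q0.integrable_const_bound[where B = 1] Q1.integrable_const_bound[where B = 1])
    have "(\<integral>\<^sup>+y. ?cost h y \<partial>M) = (\<integral>\<^sup>+y. ennreal (\<pi>0 * h y) \<partial>Q0) + (\<integral>\<^sup>+y. ennreal (\<pi>1 * (1 - h y)) \<partial>Q1)"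
      unfolding lfd by (simp add: nn_integral_add nn_integral_density)
    also have "\<dots> = ennreal (\<integral>y. \<pi>0 * h y \<partial>Q0) + ennreal (\<integral>y. \<pi>1 * (1 - h y) \<partial>Q1)"
      using int h \<pi> by (simp add: nn_integral_eq_integral)
    also have "\<dots> = ennreal (\<pi>0 * (\<integral>y. h y \<partial>Q0)) + ennreal (\<pi>1 * (1 - (\<integral>y. h y \<partial>Q1)))"
      using int by (simp add: Q1.prob_space)
    also have "\<dots> = ennreal (\<pi>0 * (\<integral>y. h y \<partial>Q0) + \<pi>1 * (1 - (\<integral>y. h y \<partial>Q1)))"
      using \<pi> h Q1.integral_le_const[OF int(2), of 1]
      by (intro ennreal_plus[symmetric] mult_nonneg_nonneg integral_nonneg) auto
    finally show ?thesis .
  qed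
  have f: "f \<in> borel_measurable M" "\<And>y. 0 \<le> f y" "\<And>y. f y \<le> 1"
    unfolding f_def by auto
  have "?cost f y \<le> ?cost h y" if reg: "regular y" for y
  proof -
    obtain a b where a: "q0 y = ennreal a" "0 < a" and b: "q1 y = ennreal b" "0 \<le> b"
      using regular_lfd(1-3)[OF reg] by (cases "q0 y"; cases "q1 y") auto
    have l: "ennreal (\<pi>0 / \<pi>1) < l y \<longleftrightarrow> \<pi>0 * a < \<pi>1 * b"
      using a b \<pi> by (simp add: divide_ennreal ennreal_less_iff field_simps)
    have *: "?cost k y = ennreal (a * \<pi>0 * k y + b * \<pi>1 * (1 - k y))"
      if "0 \<le> k y" "k y \<le> 1" for k
      using that a b \<pi> by (simp add: ennreal_mult[symmetric] ennreal_plus[symmetric] mult.assoc del: ennreal_plus)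
    have "a * \<pi>0 * f y + b * \<pi>1 * (1 - f y) \<le> a * \<pi>0 * h y + b * \<pi>1 * (1 - h y)"
    proof (cases "\<pi>0 * a < \<pi>1 * b")
      case True
      then have "0 \<le> (\<pi>1 * b - \<pi>0 * a) * (1 - h y)" using h by simp
      then show ?thesis using True l by (simp add: f_def algebra_simps)
    next
      case False
      then have "0 \<le> (\<pi>0 * a - \<pi>1 * b) * h y" using h by simp
      then show ?thesis using False l by (simp add: f_def algebra_simps)
    qed
    then show ?thesis using *[of f] *[of h] f h by (simp add: ennreal_leI)
  qed
  then have "AE y in M. ?cost f y \<le> ?cost h y"
    using AE_regular_or_zero by (auto elim!: eventually_mono simp: zero_lfd)
  then have "(\<integral>\<^sup>+y. ?cost f y \<partial>M) \<le> (\<integral>\<^sup>+y. ?cost h y \<partial>M)" by (rule nn_integral_mono_AE)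
  \<comment> \<open>An inequality between \<open>ennreal\<close> images returns to the reals only if
    its right-hand side is nonnegative.\<close>
  moreover have "0 \<le> \<pi>0 * (\<integral>y. h y \<partial>Q0) + \<pi>1 * (1 - (\<integral>y. h y \<partial>Q1))"
  proof -
    have "h \<in> borel_measurable Q1" using lfd h by auto
    then have "(\<integral>y. h y \<partial>Q1) \<le> 1" using h
      by (intro Q1.integral_le_const Q1.integrable_const_bound[where B = 1]) auto
    then show ?thesis using \<pi> h by (intro add_nonneg_nonneg mult_nonneg_nonneg integral_nonneg) auto
  qed
  ultimately show ?thesis by (simp add: cost f h)
qed

end

subsection \<open>Worst-case error\<close>

lemma error_prob_bounds:
  assumes "is_first_rule M \<phi>1" "is_rule M \<phi>"
    and R: "\<And>j. j \<in> {1..Suc k} \<Longrightarrow> R0 j \<in> space (prob_algebra M)"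
    "\<And>j. j \<in> {1..Suc k} \<Longrightarrow> R1 j \<in> space (prob_algebra M)"
    and \<pi>: "0 \<le> \<pi>0" "0 \<le> \<pi>1" "\<pi>0 + \<pi>1 = 1"
  shows "0 \<le> error_prob \<pi>0 \<pi>1 (Suc k) \<phi>1 \<phi> (PiM {1..Suc k} R0) (PiM {1..Suc k} R1)"
    "error_prob \<pi>0 \<pi>1 (Suc k) \<phi>1 \<phi> (PiM {1..Suc k} R0) (PiM {1..Suc k} R1) \<le> 1"
proof -
  note b = decision_prob_bounds[OF assms(1,2) R(1)] decision_prob_bounds[OF assms(1,2) R(2)]
  show "0 \<le> error_prob \<pi>0 \<pi>1 (Suc k) \<phi>1 \<phi> (PiM {1..Suc k} R0) (PiM {1..Suc k} R1)"
    unfolding error_prob_def using b \<pi> by (intro add_nonneg_nonneg mult_nonneg_nonneg) auto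
  show "error_prob \<pi>0 \<pi>1 (Suc k) \<phi>1 \<phi> (PiM {1..Suc k} R0) (PiM {1..Suc k} R1) \<le> 1"
    unfolding error_prob_def using b \<pi> by (intro convex_bound_le) auto
qed

lemma product_class_pairE:
  assumes "z \<in> product_class k C0 \<times> product_class k C1"
  obtains R0 R1 where "z = (PiM {1..k} R0, PiM {1..k} R1)"
    "\<forall>j\<in>{1..k}. R0 j \<in> C0" "\<forall>j\<in>{1..k}. R1 j \<in> C1"
  using assms that unfolding product_class_def mem_Times_iff mem_Collect_eq
  by (metis prod.collapse)

lemma error_prob_le_worst:
  assumes "is_first_rule M \<phi>1" "is_rule M \<phi>"
    and C: "C0 \<subseteq> space (prob_algebra M)" "C1 \<subseteq> space (prob_algebra M)"
    and R: "\<And>j. j \<in> {1..Suc k} \<Longrightarrow> R0 j \<in> C0" "\<And>j. j \<in> {1..Suc k} \<Longrightarrow> R1 j \<in> C1"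
    and \<pi>: "0 \<le> \<pi>0" "0 \<le> \<pi>1" "\<pi>0 + \<pi>1 = 1"
  shows "error_prob \<pi>0 \<pi>1 (Suc k) \<phi>1 \<phi> (PiM {1..Suc k} R0) (PiM {1..Suc k} R1)
    \<le> worst_error_prob \<pi>0 \<pi>1 C0 C1 (Suc k) \<phi>1 \<phi>"
proof -
  let ?e = "\<lambda>(L0, L1). error_prob \<pi>0 \<pi>1 (Suc k) \<phi>1 \<phi> L0 L1"
  \<comment> \<open>A real-valued supremum dominates its members only if they are bounded
    above.\<close>
  have "?e z \<le> 1" if "z \<in> product_class (Suc k) C0 \<times> product_class (Suc k) C1" for z
  proof -
    obtain R0 R1 where R: "z = (PiM {1..Suc k} R0, PiM {1..Suc k} R1)"
      "\<forall>j\<in>{1..Suc k}. R0 j \<in> C0" "\<forall>j\<in>{1..Suc k}. R1 j \<in> C1"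
      using \<open>z \<in> _\<close> by (rule product_class_pairE)
    have "error_prob \<pi>0 \<pi>1 (Suc k) \<phi>1 \<phi> (PiM {1..Suc k} R0) (PiM {1..Suc k} R1) \<le> 1"
      using R(2,3) C by (intro error_prob_bounds(2)[OF assms(1,2) _ _ \<pi>]) auto
    then show ?thesis by (simp add: R(1))
  qed
  then have "bdd_above (?e ` (product_class (Suc k) C0 \<times> product_class (Suc k) C1))"
    by (intro bdd_aboveI2)
  moreover have "(PiM {1..Suc k} R0, PiM {1..Suc k} R1) \<in> product_class (Suc k) C0 \<times> product_class (Suc k) C1"
    using R by (auto simp: product_class_def)
  ultimately have "?e (PiM {1..Suc k} R0, PiM {1..Suc k} R1)
    \<le> (SUP z\<in>product_class (Suc k) C0 \<times> product_class (Suc k) C1. ?e z)"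
    by (intro cSUP_upper)
  then show ?thesis unfolding worst_error_prob_def by simp
qed

lemma worst_error_prob_le:
  assumes "P0 \<in> C0" "P1 \<in> C1"
    and "\<And>R0 R1. (\<And>j. j \<in> {1..k} \<Longrightarrow> R0 j \<in> C0) \<Longrightarrow> (\<And>j. j \<in> {1..k} \<Longrightarrow> R1 j \<in> C1) \<Longrightarrow>
      error_prob \<pi>0 \<pi>1 k \<phi>1 \<phi> (PiM {1..k} R0) (PiM {1..k} R1) \<le> B"
  shows "worst_error_prob \<pi>0 \<pi>1 C0 C1 k \<phi>1 \<phi> \<le> B"
  unfolding worst_error_prob_def
proof (rule cSUP_least)
  \<comment> \<open>Constant factors show that the supremum ranges over a nonempty set.\<close>
  have "PiM {1..k} (\<lambda>_. P0) \<in> product_class k C0" "PiM {1..k} (\<lambda>_. P1) \<in> product_class k C1"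
    using assms(1,2) unfolding product_class_def by blast+
  then show "product_class k C0 \<times> product_class k C1 \<noteq> {}" by auto
  fix z assume "z \<in> product_class k C0 \<times> product_class k C1"
  then obtain R0 R1 where "z = (PiM {1..k} R0, PiM {1..k} R1)"
    "\<forall>j\<in>{1..k}. R0 j \<in> C0" "\<forall>j\<in>{1..k}. R1 j \<in> C1"
    by (rule product_class_pairE)
  then show "(case z of (L0, L1) \<Rightarrow> error_prob \<pi>0 \<pi>1 k \<phi>1 \<phi> L0 L1) \<le> B"
    using assms(3) by simp
qed

text \<open>
  The unknown start is absorbed by starting the extremal chains at 1 and at 0, which does not
  change their limits.
\<close>

lemma worst_error_prob_tendsto:
  assumes \<phi>1: "is_first_rule M \<phi>1" and \<phi>: "is_rule M \<phi>"
    and C: "C0 \<subseteq> space (prob_algebra M)" "C1 \<subseteq> space (prob_algebra M)"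
    and Q: "Q0 \<in> C0" "Q1 \<in> C1"
    and \<pi>: "0 \<le> \<pi>0" "0 \<le> \<pi>1" "\<pi>0 + \<pi>1 = 1"
    and mono: "\<And>y. pmf (\<phi> y False) True \<le> pmf (\<phi> y True) True"
    and dominance: "\<And>P u. P \<in> C0 \<Longrightarrow> trans_prob \<phi> P u \<le> trans_prob \<phi> Q0 u"
      "\<And>P u. P \<in> C1 \<Longrightarrow> trans_prob \<phi> Q1 u \<le> trans_prob \<phi> P u"
    and forget: "trans_prob \<phi> Q0 True - trans_prob \<phi> Q0 False < 1"
      "trans_prob \<phi> Q1 True - trans_prob \<phi> Q1 False < 1"
  defines "s \<equiv> \<lambda>Q. trans_prob \<phi> Q False / (1 - (trans_prob \<phi> Q True - trans_prob \<phi> Q False))"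
  shows "(\<lambda>k. error_prob \<pi>0 \<pi>1 k \<phi>1 \<phi> (PiM {1..k} (\<lambda>_. Q0)) (PiM {1..k} (\<lambda>_. Q1)))
      \<longlonglongrightarrow> \<pi>0 * s Q0 + \<pi>1 * (1 - s Q1)"
    and "(\<lambda>k. worst_error_prob \<pi>0 \<pi>1 C0 C1 k \<phi>1 \<phi>) \<longlonglongrightarrow> \<pi>0 * s Q0 + \<pi>1 * (1 - s Q1)"
proof -
  let ?step = "\<lambda>Q. markov_step (trans_prob \<phi> Q False) (trans_prob \<phi> Q True)"
  let ?s = "\<pi>0 * s Q0 + \<pi>1 * (1 - s Q1)"
  have Qp: "Q0 \<in> space (prob_algebra M)" "Q1 \<in> space (prob_algebra M)" using C Q by auto
  have trans_mono: "trans_prob \<phi> P False \<le> trans_prob \<phi> P True" if "P \<in> space (prob_algebra M)" for P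
    unfolding trans_prob_def using mono by (intro integral_mono integrable_rule[OF \<phi> that])
  \<comment> \<open>Monotonicity makes the slopes nonnegative and \<open>forget\<close> keeps them
    below 1, so both extremal chains contract from any start.\<close>
  have lim: "(\<lambda>n. (?step Q0 ^^ n) x) \<longlonglongrightarrow> s Q0" "(\<lambda>n. (?step Q1 ^^ n) x) \<longlonglongrightarrow> s Q1" for x
    unfolding s_def using forget trans_mono Qp by (auto intro!: markov_funpow_tendsto)
  let ?eQ = "\<lambda>k. error_prob \<pi>0 \<pi>1 k \<phi>1 \<phi> (PiM {1..k} (\<lambda>_. Q0)) (PiM {1..k} (\<lambda>_. Q1))"
  \<comment> \<open>The sequence is shifted: agent \<open>Suc n\<close> is \<open>n\<close> steps
    after agent 1, and the value at 0 is unspecified.\<close>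
  have eQ: "?eQ (Suc n) = \<pi>0 * (?step Q0 ^^ n) (\<integral>y. pmf (\<phi>1 y) True \<partial>Q0)
      + \<pi>1 * (1 - (?step Q1 ^^ n) (\<integral>y. pmf (\<phi>1 y) True \<partial>Q1))" for n
    using error_prob_eq[OF \<phi>1 \<phi>, of n "\<lambda>_. Q0" "\<lambda>_. Q1"] Qp by (simp add: decision_prob_funpow[OF \<phi>1 \<phi>] del: One_nat_def)
  have lim_eQ: "(\<lambda>n. ?eQ (Suc n)) \<longlonglongrightarrow> ?s"
    unfolding eQ by (intro tendsto_intros lim)
  then show "?eQ \<longlonglongrightarrow> ?s" by (rule LIMSEQ_imp_Suc)
  have upper: "worst_error_prob \<pi>0 \<pi>1 C0 C1 (Suc n) \<phi>1 \<phi>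
      \<le> \<pi>0 * (?step Q0 ^^ n) 1 + \<pi>1 * (1 - (?step Q1 ^^ n) 0)" for n
  proof (rule worst_error_prob_le[OF Q])
    fix R0 R1 assume R0: "\<And>j. j \<in> {1..Suc n} \<Longrightarrow> R0 j \<in> C0" and R1: "\<And>j. j \<in> {1..Suc n} \<Longrightarrow> R1 j \<in> C1"
    have R: "\<And>j. j \<in> {1..Suc n} \<Longrightarrow> R0 j \<in> space (prob_algebra M)" "\<And>j. j \<in> {1..Suc n} \<Longrightarrow> R1 j \<in> space (prob_algebra M)"
      using R0 R1 C by auto
    have iterate_bounds: "0 \<le> (?step Q1 ^^ k) 0 \<and> (?step Q1 ^^ k) 0 \<le> 1" for k
      by (induction k) (use Qp trans_prob_bounds[OF \<phi>] markov_step_bounds in auto)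
    \<comment> \<open>The laws \<open>R0\<close> may change from agent to agent, but each step lies
      below that of \<open>Q0\<close>, which is nondecreasing.\<close>
    have "decision_prob \<phi>1 \<phi> (Suc k) (PiM {1..Suc k} R0) True \<le> (?step Q0 ^^ k) 1" if "k \<le> n" for k
      using that
    proof (induction k)
      case 0
      then show ?case using decision_prob_bounds(2)[OF \<phi>1 \<phi>, of 0 R0] R(1) by simp
    next
      case (Suc k)
      have bounds: "0 \<le> decision_prob \<phi>1 \<phi> (Suc k) (PiM {1..Suc k} R0) True"
        "decision_prob \<phi>1 \<phi> (Suc k) (PiM {1..Suc k} R0) True \<le> 1"
        using R(1) Suc.prems by (intro decision_prob_bounds[OF \<phi>1 \<phi>]; simp)+
      have "decision_prob \<phi>1 \<phi> (Suc (Suc k)) (PiM {1..Suc (Suc k)} R0) True =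
        ?step (R0 (Suc (Suc k))) (decision_prob \<phi>1 \<phi> (Suc k) (PiM {1..Suc k} R0) True)"
        using R(1) Suc.prems by (intro decision_prob_step[OF \<phi>1 \<phi>]) auto
      also have "\<dots> \<le> ?step Q0 ((?step Q0 ^^ k) 1)"
        using Suc R0 dominance(1) trans_mono[OF Qp(1)] bounds by (intro markov_step_mono) auto
      finally show ?case by simp
    qed
    \<comment> \<open>In this direction the upper map is the step of the actual law
      \<open>R1\<close>, so its own monotonicity is used.\<close>
    moreover have "(?step Q1 ^^ k) 0 \<le> decision_prob \<phi>1 \<phi> (Suc k) (PiM {1..Suc k} R1) True" if "k \<le> n" for k
      using that
    proof (induction k)
      case 0
      then show ?case using decision_prob_bounds(1)[OF \<phi>1 \<phi>, of 0 R1] R(2) by simp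
    next
      case (Suc k)
      have "?step Q1 ((?step Q1 ^^ k) 0) \<le>
        ?step (R1 (Suc (Suc k))) (decision_prob \<phi>1 \<phi> (Suc k) (PiM {1..Suc k} R1) True)"
        using Suc R1 R(2) dominance(2) trans_mono iterate_bounds by (intro markov_step_mono) auto
      also have "\<dots> = decision_prob \<phi>1 \<phi> (Suc (Suc k)) (PiM {1..Suc (Suc k)} R1) True"
        using R(2) Suc.prems by (intro decision_prob_step[OF \<phi>1 \<phi>, symmetric]) auto
      finally show ?case by simp
    qed
    ultimately show "error_prob \<pi>0 \<pi>1 (Suc n) \<phi>1 \<phi> (PiM {1..Suc n} R0) (PiM {1..Suc n} R1)
      \<le> \<pi>0 * (?step Q0 ^^ n) 1 + \<pi>1 * (1 - (?step Q1 ^^ n) 0)"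
      using \<pi> R by (subst error_prob_eq[OF \<phi>1 \<phi>]) (auto intro!: add_mono mult_left_mono simp del: One_nat_def)
  qed
  have lower: "?eQ (Suc n) \<le> worst_error_prob \<pi>0 \<pi>1 C0 C1 (Suc n) \<phi>1 \<phi>" for n
    using Q by (intro error_prob_le_worst[OF \<phi>1 \<phi> C _ _ \<pi>])
  have "(\<lambda>n. \<pi>0 * (?step Q0 ^^ n) 1 + \<pi>1 * (1 - (?step Q1 ^^ n) 0)) \<longlonglongrightarrow> ?s"
    by (intro tendsto_intros lim)
  with lim_eQ have "(\<lambda>n. worst_error_prob \<pi>0 \<pi>1 C0 C1 (Suc n) \<phi>1 \<phi>) \<longlonglongrightarrow> ?s"
    by (rule tendsto_sandwich[rotated 2]) (use lower upper in auto)
  then show "(\<lambda>k. worst_error_prob \<pi>0 \<pi>1 C0 C1 k \<phi>1 \<phi>) \<longlonglongrightarrow> ?s" by (rule LIMSEQ_imp_Suc)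
qed

section \<open>Lazy rules and copying rules\<close>

text \<open>The witness applies \<open>\<phi>\<close> with probability one half and otherwise copies
  the previous decision, which makes its chains the lazy ones of \<open>lazy_markov_tendsto\<close>.
  Errors are affine in the decision probabilities, so the limits under the two hypotheses
  combine.\<close>

lemma lazy_rule_error_tendsto:
  fixes \<pi>0 \<pi>1 :: real
  assumes \<phi>1: "is_first_rule M \<phi>1" and \<phi>: "is_rule M \<phi>"
    and Q: "Q0 \<in> space (prob_algebra M)" "Q1 \<in> space (prob_algebra M)"
  defines "e \<equiv> \<lambda>\<phi> k. error_prob \<pi>0 \<pi>1 k \<phi>1 \<phi> (PiM {1..k} (\<lambda>_. Q0)) (PiM {1..k} (\<lambda>_. Q1))"
  obtains \<phi>' L where "is_rule M \<phi>'" "e \<phi>' \<longlonglongrightarrow> L" "(\<lambda>k. (e \<phi> k + e \<phi> (Suc k)) / 2) \<longlonglongrightarrow> L"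
proof -
  define \<phi>' where "\<phi>' y u = bind_pmf (bernoulli_pmf (1 / 2)) (\<lambda>z. if z then \<phi> y u else return_pmf u)" for y u
  have pmf': "pmf (\<phi>' y u) b = pmf (\<phi> y u) b / 2 + of_bool (u = b) / 2" for y u b
    by (simp add: \<phi>'_def pmf_bind_bool indicator_def)
  have \<phi>': "is_rule M \<phi>'" using \<phi> by (auto simp: is_rule_def pmf' intro!: borel_measurable_add borel_measurable_divide)
  have trans': "trans_prob \<phi>' Q u = (trans_prob \<phi> Q u + of_bool u) / 2" if "Q \<in> space (prob_algebra M)" for Q u
  proof -
    interpret prob_space Q using that by (simp add: space_prob_algebra)
    show ?thesis using integrable_rule[OF \<phi> that, of u True]
      by (simp add: trans_prob_def pmf' prob_space field_simps)
  qed
  let ?step = "\<lambda>\<phi> Q. markov_step (trans_prob \<phi> Q False) (trans_prob \<phi> Q True)"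
  let ?x = "\<lambda>Q. \<integral>y. pmf (\<phi>1 y) True \<partial>Q"
  have e: "e \<psi> (Suc n) = \<pi>0 * (?step \<psi> Q0 ^^ n) (?x Q0) + \<pi>1 * (1 - (?step \<psi> Q1 ^^ n) (?x Q1))"
    if "is_rule M \<psi>" for \<psi> n
    using error_prob_eq[OF \<phi>1 that, of n "\<lambda>_. Q0" "\<lambda>_. Q1"] Q
    by (simp add: e_def decision_prob_funpow[OF \<phi>1 that] del: One_nat_def)
  have "\<exists>L. (\<lambda>n. (?step \<phi>' Q ^^ n) (?x Q)) \<longlonglongrightarrow> L \<and>
      (\<lambda>n. ((?step \<phi> Q ^^ n) (?x Q) + (?step \<phi> Q ^^ Suc n) (?x Q)) / 2) \<longlonglongrightarrow> L"
    if "Q \<in> space (prob_algebra M)" for Q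
    using lazy_markov_tendsto[OF trans_prob_bounds[OF \<phi> that, of False] trans_prob_bounds[OF \<phi> that, of True], of "?x Q"]
    unfolding trans'[OF that] by (auto simp del: funpow.simps)
  from this[OF Q(1)] this[OF Q(2)] obtain L0 L1 where L:
    "(\<lambda>n. (?step \<phi>' Q0 ^^ n) (?x Q0)) \<longlonglongrightarrow> L0" "(\<lambda>n. (?step \<phi>' Q1 ^^ n) (?x Q1)) \<longlonglongrightarrow> L1"
    "(\<lambda>n. ((?step \<phi> Q0 ^^ n) (?x Q0) + (?step \<phi> Q0 ^^ Suc n) (?x Q0)) / 2) \<longlonglongrightarrow> L0"
    "(\<lambda>n. ((?step \<phi> Q1 ^^ n) (?x Q1) + (?step \<phi> Q1 ^^ Suc n) (?x Q1)) / 2) \<longlonglongrightarrow> L1"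
    by blast
  have "(\<lambda>n. e \<phi>' (Suc n)) \<longlonglongrightarrow> \<pi>0 * L0 + \<pi>1 * (1 - L1)"
    unfolding e[OF \<phi>'] by (intro tendsto_intros L)
  then have 1: "e \<phi>' \<longlonglongrightarrow> \<pi>0 * L0 + \<pi>1 * (1 - L1)" by (rule LIMSEQ_imp_Suc)
  have eq: "(e \<phi> (Suc n) + e \<phi> (Suc (Suc n))) / 2 =
    \<pi>0 * (((?step \<phi> Q0 ^^ n) (?x Q0) + (?step \<phi> Q0 ^^ Suc n) (?x Q0)) / 2) +
    \<pi>1 * (1 - ((?step \<phi> Q1 ^^ n) (?x Q1) + (?step \<phi> Q1 ^^ Suc n) (?x Q1)) / 2)" for n
    unfolding e[OF \<phi>] by (simp add: field_simps del: funpow.simps)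
  have "(\<lambda>n. (e \<phi> (Suc n) + e \<phi> (Suc (Suc n))) / 2) \<longlonglongrightarrow> \<pi>0 * L0 + \<pi>1 * (1 - L1)"
    unfolding eq by (intro tendsto_intros L)
  then have "(\<lambda>k. (e \<phi> k + e \<phi> (Suc k)) / 2) \<longlonglongrightarrow> \<pi>0 * L0 + \<pi>1 * (1 - L1)" by (rule LIMSEQ_imp_Suc)
  with \<phi>' 1 show ?thesis by (rule that)
qed

text \<open>Copying with probability one says that certain nonnegative functions have integral 0,
  hence vanish almost everywhere; such statements pass along absolute continuity.\<close>

lemma copying_absolutely_continuous:
  assumes \<phi>: "is_rule M \<phi>" and P: "P \<in> space (prob_algebra M)" "Q \<in> space (prob_algebra M)"
    and ac: "absolutely_continuous P Q"
    and copy: "trans_prob \<phi> P False = 0" "trans_prob \<phi> P True = 1"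
  shows "trans_prob \<phi> Q False = 0" "trans_prob \<phi> Q True = 1"
proof -
  interpret P: prob_space P using P by (simp add: space_prob_algebra)
  interpret Q: prob_space Q using P by (simp add: space_prob_algebra)
  note int = integrable_rule[OF \<phi> P(1)] integrable_rule[OF \<phi> P(2)]
  have sets: "sets Q = sets P" using P by (auto simp: space_prob_algebra)
  have "AE y in P. pmf (\<phi> y False) True = 0"
    using copy(1) int integral_nonneg_eq_0_iff_AE[of P "\<lambda>y. pmf (\<phi> y False) True"]
    by (simp add: trans_prob_def)
  then have "AE y in Q. pmf (\<phi> y False) True = 0" using absolutely_continuous_AE[OF sets ac] by blast
  then show "trans_prob \<phi> Q False = 0"
    unfolding trans_prob_def using int integral_nonneg_eq_0_iff_AE[of Q "\<lambda>y. pmf (\<phi> y False) True"] by simp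
  have "(\<integral>y. 1 - pmf (\<phi> y True) True \<partial>P) = 0"
    using copy(2) int by (simp add: trans_prob_def P.prob_space)
  then have "AE y in P. 1 - pmf (\<phi> y True) True = 0"
    using int by (subst (asm) integral_nonneg_eq_0_iff_AE) (auto simp: pmf_le_1)
  then have "AE y in Q. 1 - pmf (\<phi> y True) True = 0" using absolutely_continuous_AE[OF sets ac] by blast
  then have "(\<integral>y. 1 - pmf (\<phi> y True) True \<partial>Q) = 0"
    using int by (subst integral_nonneg_eq_0_iff_AE) (auto simp: pmf_le_1)
  then show "trans_prob \<phi> Q True = 1"
    using int by (simp add: trans_prob_def Q.prob_space)
qed

section \<open>Upper and lower bounds for the infimum\<close>

context lfd_pair
begin

text \<open>The common limit does not mention \<open>\<phi>1\<close>, so it yields admissibility and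
  the value of the worst case at once.\<close>

lemma lr_test_error_tendsto:
  assumes \<phi>: "\<phi> = lr_test l t1 t0 p q" "p \<in> {0..1}" "q \<in> {0..1}" "is_rule M \<phi>"
    and \<pi>: "0 \<le> \<pi>0" "0 \<le> \<pi>1" "\<pi>0 + \<pi>1 = 1"
    and forget: "trans_prob \<phi> Q0 True - trans_prob \<phi> Q0 False < 1"
      "trans_prob \<phi> Q1 True - trans_prob \<phi> Q1 False < 1"
    and \<phi>1: "is_first_rule M \<phi>1"
  defines "s \<equiv> \<lambda>Q. trans_prob \<phi> Q False / (1 - (trans_prob \<phi> Q True - trans_prob \<phi> Q False))"
  shows "(\<lambda>k. error_prob \<pi>0 \<pi>1 k \<phi>1 \<phi> (PiM {1..k} (\<lambda>_. Q0)) (PiM {1..k} (\<lambda>_. Q1)))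
      \<longlonglongrightarrow> \<pi>0 * s Q0 + \<pi>1 * (1 - s Q1)"
    and "(\<lambda>k. worst_error_prob \<pi>0 \<pi>1 C0 C1 k \<phi>1 \<phi>) \<longlonglongrightarrow> \<pi>0 * s Q0 + \<pi>1 * (1 - s Q1)"
proof -
  define g where "g u r = pmf (lr_test (\<lambda>r. r) t1 t0 p q r u) True" for u r
  have g: "pmf (\<phi> y u) True = g u (l y)" for y u
    unfolding g_def \<phi>(1) by (subst lr_test_ratio) (rule refl)
  have "mono (g u)" for u
    unfolding g_def using \<phi> by (intro monoI lr_test_mono) auto
  moreover have "\<bar>g u r\<bar> \<le> 1" for u r by (simp add: g_def pmf_le_1)
  moreover have "(\<lambda>y. g u (l y)) \<in> borel_measurable M" for u
    using \<phi>(4) by (simp add: is_rule_def g[symmetric])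
  ultimately have dominance: "P \<in> C0 \<Longrightarrow> trans_prob \<phi> P u \<le> trans_prob \<phi> Q0 u"
    "P \<in> C1 \<Longrightarrow> trans_prob \<phi> Q1 u \<le> trans_prob \<phi> P u" for P u
    unfolding trans_prob_def g by (intro stochastic_dominance; simp)+
  have mono: "pmf (\<phi> y False) True \<le> pmf (\<phi> y True) True" for y
    unfolding \<phi>(1) using \<phi>(2,3) by (intro lr_test_mono) auto
  note lims = worst_error_prob_tendsto[OF \<phi>1 \<phi>(4) classes_prob lfd_in_classes \<pi> mono dominance forget]
  show "(\<lambda>k. error_prob \<pi>0 \<pi>1 k \<phi>1 \<phi> (PiM {1..k} (\<lambda>_. Q0)) (PiM {1..k} (\<lambda>_. Q1)))
      \<longlonglongrightarrow> \<pi>0 * s Q0 + \<pi>1 * (1 - s Q1)"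
    "(\<lambda>k. worst_error_prob \<pi>0 \<pi>1 C0 C1 k \<phi>1 \<phi>) \<longlonglongrightarrow> \<pi>0 * s Q0 + \<pi>1 * (1 - s Q1)"
    unfolding s_def by (rule lims; assumption)+
qed

text \<open>The claim asks for some admissible rule rather than \<open>\<phi>\<close> itself because
  of the case where a slope reaches 1: the first decision then persists, and a memoryless test takes
  the place of \<open>\<phi>\<close>.\<close>

lemma admissible_rule_no_worse:
  assumes \<phi>: "is_randomized_lrt l \<phi>" "is_rule M \<phi>"
    and \<pi>: "0 < \<pi>0" "0 < \<pi>1" "\<pi>0 + \<pi>1 = 1"
    and \<phi>1: "is_first_rule M \<phi>1"
  shows "\<exists>\<psi>\<in>admissible_rules M \<pi>0 \<pi>1 C0 C1. lim (\<lambda>k. worst_error_prob \<pi>0 \<pi>1 C0 C1 k \<phi>1 \<psi>)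
    \<le> lim (\<lambda>k. error_prob \<pi>0 \<pi>1 k \<phi>1 \<phi> (PiM {1..k} (\<lambda>_. Q0)) (PiM {1..k} (\<lambda>_. Q1)))"
proof -
  have Qp: "Q0 \<in> space (prob_algebra M)" "Q1 \<in> space (prob_algebra M)"
    using lfd_in_classes classes_prob by auto
  have \<pi>': "0 \<le> \<pi>0" "0 \<le> \<pi>1" using \<pi> by auto
  obtain t1 t0 p q where lrt: "\<phi> = lr_test l t1 t0 p q" "p \<in> {0..1}" "q \<in> {0..1}"
    using \<phi>(1) unfolding is_randomized_lrt_def by blast
  show ?thesis
  proof (cases "trans_prob \<phi> Q0 True - trans_prob \<phi> Q0 False < 1 \<and>
      trans_prob \<phi> Q1 True - trans_prob \<phi> Q1 False < 1")
    case True
    then have forget: "trans_prob \<phi> Q0 True - trans_prob \<phi> Q0 False < 1"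
      "trans_prob \<phi> Q1 True - trans_prob \<phi> Q1 False < 1" by auto
    note lims = lr_test_error_tendsto[OF lrt \<phi>(2) \<pi>' \<pi>(3) forget]
    have "\<phi> \<in> admissible_rules M \<pi>0 \<pi>1 C0 C1"
      using \<phi>(2) lims(2) unfolding admissible_rules_def by blast
    moreover note limI[OF lims(1)[OF \<phi>1]] limI[OF lims(2)[OF \<phi>1]]
    ultimately show ?thesis by force
  next
    case False
    define x where "x Q = (\<integral>y. pmf (\<phi>1 y) True \<partial>Q)" for Q
    have ac: "absolutely_continuous Q0 Q1" "absolutely_continuous Q1 Q0"
      using mutually_ac lfd_in_classes by auto
    \<comment> \<open>Transition probabilities lie in the unit interval, so a slope of at least 1
      forces the values 0 and 1.\<close>
    have "trans_prob \<phi> Q0 False = 0 \<and> trans_prob \<phi> Q0 True = 1 \<or>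
        trans_prob \<phi> Q1 False = 0 \<and> trans_prob \<phi> Q1 True = 1"
      using False trans_prob_bounds[OF \<phi>(2) Qp(1), of True] trans_prob_bounds[OF \<phi>(2) Qp(1), of False]
        trans_prob_bounds[OF \<phi>(2) Qp(2), of True] trans_prob_bounds[OF \<phi>(2) Qp(2), of False]
      by linarith
    then have copy: "trans_prob \<phi> Q0 False = 0" "trans_prob \<phi> Q0 True = 1"
        "trans_prob \<phi> Q1 False = 0" "trans_prob \<phi> Q1 True = 1"
      using copying_absolutely_continuous[OF \<phi>(2) Qp ac(1)]
        copying_absolutely_continuous[OF \<phi>(2) Qp(2,1) ac(2)] by auto
    have "markov_step 0 1 = id" by (auto simp: markov_step_def)
    then have "decision_prob \<phi>1 \<phi> (Suc n) (PiM {1..Suc n} (\<lambda>_. Q0)) True = x Q0"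
      "decision_prob \<phi>1 \<phi> (Suc n) (PiM {1..Suc n} (\<lambda>_. Q1)) True = x Q1" for n
      using decision_prob_funpow[OF \<phi>1 \<phi>(2) Qp(1), of n] decision_prob_funpow[OF \<phi>1 \<phi>(2) Qp(2), of n] copy
      by (simp_all add: x_def)
    then have "error_prob \<pi>0 \<pi>1 (Suc n) \<phi>1 \<phi> (PiM {1..Suc n} (\<lambda>_. Q0)) (PiM {1..Suc n} (\<lambda>_. Q1))
        = \<pi>0 * x Q0 + \<pi>1 * (1 - x Q1)" for n
      using Qp by (subst error_prob_eq[OF \<phi>1 \<phi>(2)]) auto
    then have "(\<lambda>n. error_prob \<pi>0 \<pi>1 (Suc n) \<phi>1 \<phi> (PiM {1..Suc n} (\<lambda>_. Q0)) (PiM {1..Suc n} (\<lambda>_. Q1)))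
        \<longlonglongrightarrow> \<pi>0 * x Q0 + \<pi>1 * (1 - x Q1)"
      by simp
    from limI[OF LIMSEQ_imp_Suc[OF this]]
    have limit: "lim (\<lambda>k. error_prob \<pi>0 \<pi>1 k \<phi>1 \<phi> (PiM {1..k} (\<lambda>_. Q0)) (PiM {1..k} (\<lambda>_. Q1)))
        = \<pi>0 * x Q0 + \<pi>1 * (1 - x Q1)" .
    \<comment> \<open>The ratio at which \<open>\<pi>0 * q0 = \<pi>1 * q1\<close>. The test built on
      it ignores the previous decision, so its slopes are 0.\<close>
    let ?t = "\<pi>0 / \<pi>1"
    define \<psi> where "\<psi> = lr_test l (ereal ?t) (ereal ?t) 1 1"
    have \<psi>: "\<psi> y u = return_pmf (ennreal ?t < l y)" for y u
      unfolding \<psi>_def using \<pi>' by (intro lr_test_threshold) simp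
    have pmf_\<psi>: "pmf (\<psi> y u) b = of_bool ((ennreal ?t < l y) = b)" for y u b
      by (simp add: \<psi> indicator_def)
    have rule: "is_rule M \<psi>" unfolding is_rule_def pmf_\<psi> by measurable
    have trans_\<psi>: "trans_prob \<psi> Q u = (\<integral>y. of_bool (ennreal ?t < l y) \<partial>Q)" for Q u
      by (simp add: trans_prob_def pmf_\<psi>)
    have 1: "1 \<in> {0..1::real}" by simp
    have forget: "trans_prob \<psi> Q True - trans_prob \<psi> Q False < 1" for Q
      by (simp add: trans_\<psi>)
    note lims = lr_test_error_tendsto(2)[OF \<psi>_def 1 1 rule \<pi>' \<pi>(3) forget forget]
    have "\<psi> \<in> admissible_rules M \<pi>0 \<pi>1 C0 C1"
      using rule lims unfolding admissible_rules_def by blast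
    \<comment> \<open>The rule \<open>\<phi>1\<close> of the first agent is itself a randomized test
      on one observation and serves as the competitor \<open>h\<close>.\<close>
    moreover have "\<pi>0 * trans_prob \<psi> Q0 False + \<pi>1 * (1 - trans_prob \<psi> Q1 False) \<le> \<pi>0 * x Q0 + \<pi>1 * (1 - x Q1)"
      unfolding trans_\<psi> x_def using \<phi>1 \<pi>
      by (intro bayes_threshold_optimal) (auto simp: is_first_rule_def pmf_le_1)
    then have "lim (\<lambda>k. worst_error_prob \<pi>0 \<pi>1 C0 C1 k \<phi>1 \<psi>) \<le> \<pi>0 * x Q0 + \<pi>1 * (1 - x Q1)"
      using limI[OF lims[OF \<phi>1]] by (simp add: trans_\<psi>)
    ultimately show ?thesis unfolding limit by blast
  qed
qed

text \<open>Admissibility speaks of convergence of the worst-case error, whereas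
  \<open>optimal\<close> asks for convergence under the least favorable pair. The lazy version
  satisfies the latter, and its limit is that of averages of consecutive errors of
  \<open>\<phi>\<close>, which stay below the averaged worst cases.\<close>

lemma optimal_error_le_worst:
  assumes \<phi>1: "is_first_rule M \<phi>1" and \<pi>: "0 \<le> \<pi>0" "0 \<le> \<pi>1" "\<pi>0 + \<pi>1 = 1"
  defines "e \<equiv> \<lambda>\<phi> k. error_prob \<pi>0 \<pi>1 k \<phi>1 \<phi> (PiM {1..k} (\<lambda>_. Q0)) (PiM {1..k} (\<lambda>_. Q1))"
  assumes optimal: "\<And>\<psi>. is_rule M \<psi> \<Longrightarrow> convergent (e \<psi>) \<Longrightarrow> V \<le> lim (e \<psi>)"
    and \<phi>: "\<phi> \<in> admissible_rules M \<pi>0 \<pi>1 C0 C1"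
  shows "V \<le> lim (\<lambda>k. worst_error_prob \<pi>0 \<pi>1 C0 C1 k \<phi>1 \<phi>)"
proof -
  let ?w = "\<lambda>k. worst_error_prob \<pi>0 \<pi>1 C0 C1 k \<phi>1 \<phi>"
  have rule: "is_rule M \<phi>" using \<phi> by (simp add: admissible_rules_def)
  obtain W where W: "?w \<longlonglongrightarrow> W" using \<phi> \<phi>1 by (auto simp: admissible_rules_def)
  have Qp: "Q0 \<in> space (prob_algebra M)" "Q1 \<in> space (prob_algebra M)"
    using lfd_in_classes classes_prob by auto
  obtain \<phi>' L where lazy: "is_rule M \<phi>'" "e \<phi>' \<longlonglongrightarrow> L" "(\<lambda>k. (e \<phi> k + e \<phi> (Suc k)) / 2) \<longlonglongrightarrow> L"
    unfolding e_def by (rule lazy_rule_error_tendsto[OF \<phi>1 rule Qp])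
  have "V \<le> L" using optimal[OF lazy(1)] lazy(2) by (auto simp: convergent_def limI)
  also have "L \<le> (W + W) / 2"
  proof (rule LIMSEQ_le[OF lazy(3)])
    show "(\<lambda>k. (?w k + ?w (Suc k)) / 2) \<longlonglongrightarrow> (W + W) / 2"
      by (intro tendsto_intros W LIMSEQ_Suc[OF W]) simp
    have "e \<phi> (Suc k) \<le> ?w (Suc k)" for k
      unfolding e_def using lfd_in_classes by (intro error_prob_le_worst[OF \<phi>1 rule classes_prob _ _ \<pi>])
    \<comment> \<open>The comparison starts at 1, the values for zero agents being
      unspecified.\<close>
    then have "e \<phi> k \<le> ?w k" if "1 \<le> k" for k using that by (cases k) auto
    then show "\<exists>N. \<forall>n\<ge>N. (e \<phi> n + e \<phi> (Suc n)) / 2 \<le> (?w n + ?w (Suc n)) / 2"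
      by (intro exI[of _ 1]) (auto intro!: divide_right_mono add_mono)
  qed
  also have "(W + W) / 2 = lim ?w" using limI[OF W] by simp
  finally show ?thesis .
qed

end

theorem theorem6:
  fixes M P0 P1 Q0 Q1 :: "'a measure"
    and p0 p1 q0 q1 :: "'a \<Rightarrow> ennreal"
    and \<epsilon>0 \<epsilon>1 \<pi>0 \<pi>1 :: real
    and c' c'' :: ennreal
    and C0 C1 :: "'a measure set"
    and \<phi>1 :: "'a first_rule"
    and \<phi>s :: "'a rule"
  assumes priors: "0 < \<pi>0" "\<pi>0 < 1" "0 < \<pi>1" "\<pi>1 < 1" "\<pi>0 + \<pi>1 = 1"
    and contamination: "0 \<le> \<epsilon>0" "\<epsilon>0 < 1" "0 \<le> \<epsilon>1" "\<epsilon>1 < 1"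
    and nominal: "P0 \<in> space (prob_algebra M)" "P1 \<in> space (prob_algebra M)"
    and densities: "p0 \<in> borel_measurable M" "P0 = density M p0"
                   "p1 \<in> borel_measurable M" "P1 = density M p1"
    and classes: "C0 = contamination_class M \<epsilon>0 P0" "C1 = contamination_class M \<epsilon>1 P1"
    and disjoint: "C0 \<inter> C1 = {}"
    and mutually_ac: "\<And>P P'. P \<in> C0 \<union> C1 \<Longrightarrow> P' \<in> C0 \<union> C1 \<Longrightarrow> absolutely_continuous P P'"
    and lfd_densities: "q0 = lfd_density0 \<epsilon>0 p0 p1 c''" "q1 = lfd_density1 \<epsilon>1 p0 p1 c'"
    and clipping: "c' < c''"
    and lfd: "Q0 = density M q0" "prob_space Q0" "Q1 = density M q1" "prob_space Q1"
    and first_rule: "is_first_rule M \<phi>1"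
    and lrt: "is_randomized_lrt (\<lambda>y. q1 y / q0 y) \<phi>s"
    and optimal: "is_arg_min
      (\<lambda>\<phi>. lim (\<lambda>k. error_prob \<pi>0 \<pi>1 k \<phi>1 \<phi> (PiM {1..k} (\<lambda>_. Q0)) (PiM {1..k} (\<lambda>_. Q1))))
      (\<lambda>\<phi>. is_rule M \<phi> \<and>
        convergent (\<lambda>k. error_prob \<pi>0 \<pi>1 k \<phi>1 \<phi> (PiM {1..k} (\<lambda>_. Q0)) (PiM {1..k} (\<lambda>_. Q1))))
      \<phi>s"
  shows "(INF \<phi>\<in>admissible_rules M \<pi>0 \<pi>1 C0 C1.
            lim (\<lambda>k. worst_error_prob \<pi>0 \<pi>1 C0 C1 k \<phi>1 \<phi>))
         = lim (\<lambda>k. error_prob \<pi>0 \<pi>1 k \<phi>1 \<phi>s (PiM {1..k} (\<lambda>_. Q0)) (PiM {1..k} (\<lambda>_. Q1)))"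
proof -
  interpret lfd_pair M P0 P1 p0 p1 \<epsilon>0 \<epsilon>1 c' c'' C0 C1 q0 q1 Q0 Q1
    by (rule lfd_pair.intro) fact+
  let ?e = "\<lambda>\<phi> k. error_prob \<pi>0 \<pi>1 k \<phi>1 \<phi> (PiM {1..k} (\<lambda>_. Q0)) (PiM {1..k} (\<lambda>_. Q1))"
  let ?w = "\<lambda>\<phi>. lim (\<lambda>k. worst_error_prob \<pi>0 \<pi>1 C0 C1 k \<phi>1 \<phi>)"
  have \<pi>: "0 \<le> \<pi>0" "0 \<le> \<pi>1" using priors by auto
  have opt: "is_rule M \<phi>s" "\<And>\<psi>. is_rule M \<psi> \<Longrightarrow> convergent (?e \<psi>) \<Longrightarrow> lim (?e \<phi>s) \<le> lim (?e \<psi>)"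
    using optimal unfolding is_arg_min_linorder by auto
  have lower: "lim (?e \<phi>s) \<le> ?w \<phi>" if "\<phi> \<in> admissible_rules M \<pi>0 \<pi>1 C0 C1" for \<phi>
    by (rule optimal_error_le_worst[OF first_rule \<pi> priors(5) opt(2) that])
  \<comment> \<open>This rule bounds the infimum from above and also shows that it ranges over a
    nonempty set, as the greatest-lower-bound argument requires.\<close>
  obtain \<psi> where \<psi>: "\<psi> \<in> admissible_rules M \<pi>0 \<pi>1 C0 C1" "?w \<psi> \<le> lim (?e \<phi>s)"
    using admissible_rule_no_worse[OF lrt opt(1) priors(1,3,5) first_rule] by blast
  show ?thesis
  proof (rule antisym)
    show "(INF \<phi>\<in>admissible_rules M \<pi>0 \<pi>1 C0 C1. ?w \<phi>) \<le> lim (?e \<phi>s)"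
    proof -
      have "bdd_below (?w ` admissible_rules M \<pi>0 \<pi>1 C0 C1)" using lower by (rule bdd_belowI2)
      from cINF_lower[OF this \<psi>(1)] \<psi>(2) show ?thesis by (rule order_trans)
    qed
    show "lim (?e \<phi>s) \<le> (INF \<phi>\<in>admissible_rules M \<pi>0 \<pi>1 C0 C1. ?w \<phi>)"
      using \<psi>(1) lower by (intro cINF_greatest) auto
  qed
qed

end
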